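(* Let $k\ge n\ge 1$ and let $f_1,\dots,f_k$ be tropical polynomials in $n$ variables with finite coefficients. Then the number of isolated solutions of the system $f_1,\dots,f_k$ is not greater than $$\frac{\binom{k}{n}}{k-n+1}\,D,$$ where $D$ is the product of the $n$ greatest tropical degrees of the given polynomials.
   Context: A tropical polynomial $f$ in $n$ variables is given by a nonempty finite set of tropical monomials $Q_j(x)=a_j+i_{j1}x_1+\cdots+i_{jn}x_n$ with $a_j\in\mathbb{R}$ and pairwise distinct exponent vectors $(i_{j1},\dots,i_{jn})\in\mathbb{Z}_{\ge 0}^n$; $f(x)=\min_j Q_j(x)$. The tropical degree of $Q_j$ is $i_{j1}+\cdots+i_{jn}$, and the tropical degree of $f$ is the maximum of the degrees of its monomials. A tropical polynomial of tropical degree $e$ has finite coefficients if every monomial of tropical degree at most $e$ occurs in it. A point $x\in\mathbb{R}^n$ is a tropical zero of $f$ if $\min_j Q_j(x)$ is attained for at least two different values of $j$. A solution of a system is a point of $\mathbb{R}^n$ that is a tropical zero of every polynomial of the system; an isolated solution is an isolated point of the set of all solutions. *)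

theory Defs
  imports "HOL-Analysis.Analysis"
begin

text \<open>
  A tropical polynomial in the variables indexed by \<open>'n\<close> is a finite map from exponent
  vectors to real coefficients. Exponents outside the domain do not occur (their coefficient
  is infinite); using a map makes the exponent vectors of the monomials pairwise distinct.
\<close>

type_synonym 'n tpoly = "nat ^ 'n \<Rightarrow> real option"

definition tropical_poly :: "'n::finite tpoly \<Rightarrow> bool" where
  "tropical_poly f \<longleftrightarrow> finite (dom f) \<and> dom f \<noteq> {}"

definition tmonom :: "real \<Rightarrow> nat ^ 'n \<Rightarrow> real ^ 'n \<Rightarrow> real" where
  "tmonom a i x = a + (\<Sum>v\<in>UNIV. real (i $ v) * x $ v)"

definition teval :: "'n::finite tpoly \<Rightarrow> real ^ 'n \<Rightarrow> real" where
  "teval f x = Min ((\<lambda>i. tmonom (the (f i)) i x) ` dom f)"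

definition monom_tdegree :: "nat ^ 'n \<Rightarrow> nat" where
  "monom_tdegree i = (\<Sum>v\<in>UNIV. i $ v)"

definition tdegree :: "'n::finite tpoly \<Rightarrow> nat" where
  "tdegree f = Max (monom_tdegree ` dom f)"

definition finite_coeffs :: "'n::finite tpoly \<Rightarrow> bool" where
  "finite_coeffs f \<longleftrightarrow> {i. monom_tdegree i \<le> tdegree f} \<subseteq> dom f"

definition tropical_zero :: "'n::finite tpoly \<Rightarrow> real ^ 'n \<Rightarrow> bool" where
  "tropical_zero f x \<longleftrightarrow>
     (\<exists>i\<in>dom f. \<exists>j\<in>dom f. i \<noteq> j \<and>
        tmonom (the (f i)) i x = teval f x \<and> tmonom (the (f j)) j x = teval f x)"

definition solutions :: "'n::finite tpoly list \<Rightarrow> (real ^ 'n) set" where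
  "solutions fs = {x. \<forall>f\<in>set fs. tropical_zero f x}"

definition isolated_solutions :: "'n::finite tpoly list \<Rightarrow> (real ^ 'n) set" where
  "isolated_solutions fs = {x. x isolated_in solutions fs}"

text \<open>Product of the \<open>n\<close> greatest entries of a list, counted with multiplicity.\<close>

definition prod_greatest :: "nat \<Rightarrow> nat list \<Rightarrow> nat" where
  "prod_greatest n ds = prod_list (take n (rev (sort ds)))"

end

theory Submission
  imports Defs "HOL-Analysis.Analysis"
begin

text \<open>
  The monomials of \<open>f\<^sub>i\<close> that attain the minimum at \<open>x\<close> form the cell of \<open>f\<^sub>i\<close> at \<open>x\<close>; the hulls of the
  Minkowski sums of these cells tile the Minkowski sum of the Newton polytopes. Taking the alternating sum of
  volumes over all subsystems shows that the mixed volume of \<open>n\<close> polynomials is the sum over all \<open>x\<close> of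
  the mixed volumes of their cells at \<open>x\<close>. For a generic lift only points where every cell is nontrivial
  contribute, hence mixed volumes are nonnegative, and at least \<open>1\<close> whenever the cells contain \<open>n\<close> linearly
  independent integral differences. As the Newton polytopes are dilated standard simplices, at most
  \<open>d\<^sub>1 \<cdots> d\<^sub>n\<close> points are transversal for given \<open>n\<close> polynomials.

  At an isolated solution some \<open>n\<close> of the \<open>k\<close> polynomials are transversal, by Rado's theorem and the existence
  of mixed cells. By basis exchange, every other polynomial occurs in a further transversal \<open>n\<close>-subset, so there
  are at least \<open>k - n + 1\<close> of them, and double counting gives the bound.
\<close>

section \<open>Tilings induced by lifted point configurations\<close>

text \<open>A point that is isolated for the whole system may be isolated for none of its
  \<open>n\<close>-subsystems. In the plane, three polynomials whose zero sets near the origin are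
  the line pairs \<open>x = 0, y = 0\<close>, then \<open>x = 0, x = y\<close>, then
  \<open>y = 0, x = y\<close>, meet there only at the origin, although any two of them share a line.
  What is counted for \<open>n\<close> polynomials is therefore not isolated solutions but points
  satisfying \<open>transversal_basis\<close>, a linear condition on the cells that forces a local
  mixed volume of at least 1 whether or not the point is isolated. The given coefficients may be
  arbitrarily degenerate and are never perturbed. Genericity enters one level deeper: the cells at a
  fixed point are treated as a configuration of their own, and that configuration receives a fresh
  generic lift. For this reason the decomposition of mixed volumes over points is proved for
  arbitrary lifts; it serves the original system, the generic lifts of its cells, and the search for
  a direction in which all ties survive.\<close>

definition cvol :: "'a::euclidean_space set \<Rightarrow> real" where
  "cvol X = measure lebesgue (convex hull X)"

text \<open>Indices are collected rather than points, because a Minkowski sum is indexed by tuples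
  of summands, and several tuples with different heights can have the same sum.\<close>

definition tcell :: "('k \<Rightarrow> 'a::euclidean_space) \<Rightarrow> ('k \<Rightarrow> real) \<Rightarrow> 'k set \<Rightarrow> 'a \<Rightarrow> 'k set" where
  "tcell P b K x = {k \<in> K. \<forall>l\<in>K. b k + P k \<bullet> x \<le> b l + P l \<bullet> x}"

lemma tcell_subset: "tcell P b K x \<subseteq> K"
  by (auto simp: tcell_def)

lemma finite_tcell: "finite K \<Longrightarrow> finite (tcell P b K x)"
  by (rule finite_subset[OF tcell_subset])

lemma tcell_eq: "k \<in> tcell P b K x \<Longrightarrow> l \<in> tcell P b K x \<Longrightarrow> b k + P k \<bullet> x = b l + P l \<bullet> x"
  by (force simp: tcell_def)

lemma tcell_nonempty:
  assumes "finite K" "K \<noteq> {}" shows "tcell P b K x \<noteq> {}"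
proof -
  obtain k where "k \<in> K" "\<forall>l\<in>K. b k + P k \<bullet> x \<le> b l + P l \<bullet> x"
    using assms ex_is_arg_min_if_finite[of K "\<lambda>k. b k + P k \<bullet> x"]
    by (auto simp: is_arg_min_linorder)
  then show ?thesis by (auto simp: tcell_def)
qed

lemma lmeasurable_hull_finite: "finite X \<Longrightarrow> convex hull X \<in> lmeasurable"
  by (simp add: finite_imp_compact compact_convex_hull lmeasurable_compact)

lemma cvol_nonneg: "0 \<le> cvol X"
  by (simp add: cvol_def)

lemma cvol_eq_0_iff:
  assumes "finite X" shows "cvol X = 0 \<longleftrightarrow> negligible (convex hull X)"
  using lmeasurable_hull_finite[OF assms] by (simp add: cvol_def negligible_iff_measure)

lemma cvol_translation: "cvol ((+) c ` X) = cvol X"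
  by (simp add: cvol_def convex_hull_translation measure_translation)

lemma cvol_mono:
  assumes "finite Y" "X \<subseteq> convex hull Y" shows "cvol X \<le> cvol Y"
proof -
  have "convex hull X \<subseteq> convex hull Y"
    using assms by (simp add: hull_minimal)
  moreover have "finite Y \<Longrightarrow> convex hull Y \<in> lmeasurable"
    by (rule lmeasurable_hull_finite)
  moreover have "convex hull X \<in> sets lebesgue"
    by (intro fmeasurableD measurable_convex bounded_subset[OF _ \<open>convex hull X \<subseteq> convex hull Y\<close>])
      (auto simp: assms finite_imp_bounded bounded_convex_hull)
  ultimately show ?thesis
    unfolding cvol_def by (intro measure_mono_fmeasurable) (auto simp: assms)
qed

text \<open>Let \<open>F\<close> be the minimum of the functions
  \<open>b k + P k \<bullet> x\<close>. The function of an index in the cell at \<open>x\<close>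
  equals \<open>F\<close> at \<open>x\<close> and is at least \<open>F\<close> at \<open>y\<close>;
  for the cell at \<open>y\<close> the roles are exchanged. Subtracting shows that the level
  \<open>c = F y - F x\<close> of \<open>y - x\<close> separates the two hulls.\<close>

lemma hull_tcells_in_hyperplane:
  assumes "x \<noteq> y"
  obtains c where "(convex hull (P ` tcell P b K x)) \<inter> (convex hull (P ` tcell P b K y)) \<subseteq> {w. (y - x) \<bullet> w = c}"
proof (cases "tcell P b K x = {} \<or> tcell P b K y = {}")
  case True
  then show ?thesis using that by fastforce
next
  case False
  then obtain k l where k: "k \<in> tcell P b K x" and l: "l \<in> tcell P b K y" by auto
  define c where "c = (b l + P l \<bullet> y) - (b k + P k \<bullet> x)"
  have "convex hull (P ` tcell P b K x) \<subseteq> {w. (y - x) \<bullet> w \<ge> c}"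
  proof (rule hull_minimal)
    show "P ` tcell P b K x \<subseteq> {w. (y - x) \<bullet> w \<ge> c}"
    proof clarsimp
      fix m assume m: "m \<in> tcell P b K x"
      have "b m + P m \<bullet> x = b k + P k \<bullet> x" using tcell_eq[OF m k] .
      moreover have "b l + P l \<bullet> y \<le> b m + P m \<bullet> y" using l m by (auto simp: tcell_def)
      ultimately show "c \<le> (y - x) \<bullet> P m" by (simp add: c_def inner_diff_left inner_diff_right inner_commute)
    qed
  qed (rule convex_halfspace_ge)
  moreover have "convex hull (P ` tcell P b K y) \<subseteq> {w. (y - x) \<bullet> w \<le> c}"
  proof (rule hull_minimal)
    show "P ` tcell P b K y \<subseteq> {w. (y - x) \<bullet> w \<le> c}"
    proof clarsimp
      fix m assume m: "m \<in> tcell P b K y"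
      have "b m + P m \<bullet> y = b l + P l \<bullet> y" using tcell_eq[OF m l] .
      moreover have "b k + P k \<bullet> x \<le> b m + P m \<bullet> x" using k m by (auto simp: tcell_def)
      ultimately show "(y - x) \<bullet> P m \<le> c" by (simp add: c_def inner_diff_left inner_diff_right inner_commute)
    qed
  qed (rule convex_halfspace_le)
  ultimately show ?thesis by (intro that[of c]) force
qed

lemma negligible_hull_tcells_Int:
  assumes "x \<noteq> y"
  shows "negligible ((convex hull (P ` tcell P b K x)) \<inter> (convex hull (P ` tcell P b K y)))"
proof -
  obtain c where "(convex hull (P ` tcell P b K x)) \<inter> (convex hull (P ` tcell P b K y)) \<subseteq> {w. (y - x) \<bullet> w = c}"
    using hull_tcells_in_hyperplane[OF assms] by blast
  then show ?thesis
    using assms by (intro negligible_subset[OF negligible_hyperplane]) auto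
qed

text \<open>The point \<open>x\<close> maximizes the concave piecewise linear function \<open>min\<^sub>k (b k + (P k - w) \<bullet> x)\<close>.\<close>

lemma interior_hull_in_tcell_hull:
  assumes "finite K" and w: "w \<in> interior (convex hull (P ` K))"
  obtains x where "w \<in> convex hull (P ` tcell P b K x)"
proof -
  have "K \<noteq> {}" using w by auto
  define g where "g = (\<lambda>x. Min ((\<lambda>k. b k + (P k - w) \<bullet> x) ` K))"
  have g_le: "g x \<le> b k + (P k - w) \<bullet> x" if "k \<in> K" for x k
    unfolding g_def using assms(1) that by (intro Min_le) auto
  have g_less: "g x > c" if "\<And>k. k \<in> K \<Longrightarrow> b k + (P k - w) \<bullet> x > c" for x c
    unfolding g_def using assms(1) \<open>K \<noteq> {}\<close> that by (subst Min_gr_iff) auto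
  have g_ex: "\<exists>k\<in>K. g x = b k + (P k - w) \<bullet> x" for x
  proof -
    have "g x \<in> (\<lambda>k. b k + (P k - w) \<bullet> x) ` K"
      unfolding g_def using assms(1) \<open>K \<noteq> {}\<close> by (intro Min_in) auto
    then show ?thesis by (rule imageE) blast
  qed
  have cont: "continuous_on UNIV g"
    unfolding g_def using assms(1) \<open>K \<noteq> {}\<close>
  proof (induction rule: finite_ne_induct)
    case (singleton k)
    then show ?case by (auto intro!: continuous_intros)
  next
    case (insert k K)
    then have "(\<lambda>x. Min ((\<lambda>k. b k + (P k - w) \<bullet> x) ` insert k K))
      = (\<lambda>x. min (b k + (P k - w) \<bullet> x) (Min ((\<lambda>k. b k + (P k - w) \<bullet> x) ` K)))"
      by (auto simp: fun_eq_iff)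
    then show ?case using insert by (auto intro!: continuous_intros)
  qed
  obtain r where r: "r > 0" "cball w r \<subseteq> convex hull (P ` K)"
    using w by (meson mem_interior_cball)
  define B where "B = Max (b ` K)"
  have B: "b k \<le> B" if "k \<in> K" for k using that assms(1) by (auto simp: B_def)
  \<comment> \<open>The point at distance \<open>r\<close> from \<open>w\<close> in direction
    \<open>-x\<close> still lies in the hull, so some \<open>P k\<close> is at least as far in that
    direction. Hence \<open>g\<close> decays linearly.\<close>
  have bound: "g x \<le> B - r * norm x" for x
  proof -
    have "\<exists>k\<in>K. (P k - w) \<bullet> x \<le> - r * norm x"
    proof (rule ccontr)
      assume "\<not> ?thesis"
      then have *: "x \<bullet> P k > x \<bullet> w - r * norm x" if "k \<in> K" for k
        using that by (force simp: inner_diff_left inner_commute[of x] not_le)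
      have "convex hull (P ` K) \<subseteq> {z. x \<bullet> z > x \<bullet> w - r * norm x}"
        using * by (intro hull_minimal convex_halfspace_gt) auto
      moreover have "w - (r / norm x) *\<^sub>R x \<in> cball w r"
        using r by (cases "x = 0") (auto simp: dist_norm)
      ultimately have "x \<bullet> (w - (r / norm x) *\<^sub>R x) > x \<bullet> w - r * norm x"
        using r by blast
      then show False
        by (cases "x = 0") (auto simp: inner_diff_right norm_eq_sqrt_inner field_simps)
    qed
    then obtain k where "k \<in> K" "(P k - w) \<bullet> x \<le> - r * norm x" by blast
    then show ?thesis using g_le[of k x] B[of k] by linarith
  qed
  \<comment> \<open>Beyond this radius the linear bound drops below \<open>g 0\<close>.\<close>
  define R where "R = (B - g 0) / r"
  have "R \<ge> 0" using bound[of 0] r by (auto simp: R_def)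
  have "\<exists>x\<in>cball 0 R. \<forall>y\<in>cball 0 R. g y \<le> g x"
    using \<open>R \<ge> 0\<close> by (intro continuous_attains_sup continuous_on_subset[OF cont]) auto
  then obtain x where x: "x \<in> cball 0 R" "\<And>y. y \<in> cball 0 R \<Longrightarrow> g y \<le> g x" by blast
  have max: "g y \<le> g x" for y
  proof (cases "y \<in> cball 0 R")
    case False
    then have "norm y > R" by simp
    then have "r * norm y > r * R" using r by simp
    then have "r * norm y > B - g 0" using r by (simp add: R_def)
    then have "g y \<le> g 0" using bound[of y] by linarith
    also have "g 0 \<le> g x" using x(2)[of 0] \<open>R \<ge> 0\<close> by simp
    finally show ?thesis .
  qed (use x in auto)
  \<comment> \<open>Otherwise a direction \<open>u\<close> separating \<open>w\<close> from this
    hull increases every function active at \<open>x\<close> to first order, while the inactive ones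
    stay above \<open>g x\<close> for small \<open>t\<close>, against maximality.\<close>
  have "w \<in> convex hull (P ` tcell P b K x)"
  proof (rule ccontr)
    assume "w \<notin> convex hull (P ` tcell P b K x)"
    moreover have "closed (convex hull (P ` tcell P b K x))"
      by (intro compact_imp_closed compact_convex_hull finite_imp_compact finite_imageI finite_tcell assms)
    ultimately obtain u c where u: "u \<bullet> w < c" "\<And>z. z \<in> convex hull (P ` tcell P b K x) \<Longrightarrow> u \<bullet> z > c"
      using separating_hyperplane_closed_point[OF convex_convex_hull] by blast
    have "eventually (\<lambda>t. b k + (P k - w) \<bullet> (x + t *\<^sub>R u) > g x) (at_right 0)" if k: "k \<in> K" for k
    proof (cases "k \<in> tcell P b K x")
      case True
      have "u \<bullet> P k > c" using True by (intro u(2) hull_inc) auto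
      then have pos: "(P k - w) \<bullet> u > 0" using u(1) by (simp add: inner_diff_right inner_commute[of _ u])
      show ?thesis
        using eventually_at_right_less
      proof eventually_elim
        case (elim t)
        have "g x < g x + t * ((P k - w) \<bullet> u)" using pos elim by simp
        also have "\<dots> \<le> b k + (P k - w) \<bullet> (x + t *\<^sub>R u)"
          using g_le[OF k, of x] by (simp add: inner_add_right)
        finally show ?case .
      qed
    next
      case False
      obtain l where l: "l \<in> K" "g x = b l + (P l - w) \<bullet> x" using g_ex by blast
      obtain m where "m \<in> K" "b k + P k \<bullet> x > b m + P m \<bullet> x"
        using False k by (auto simp: tcell_def not_le)
      then have "g x < b k + (P k - w) \<bullet> x"
        using g_le[of m x] by (simp add: inner_diff_left)
      moreover have "((\<lambda>t. b k + (P k - w) \<bullet> (x + t *\<^sub>R u)) \<longlongrightarrow> b k + (P k - w) \<bullet> (x + 0 *\<^sub>R u)) (at_right 0)"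
        by (intro tendsto_intros)
      ultimately show ?thesis using order_tendstoD(1) by fastforce
    qed
    then have "eventually (\<lambda>t. \<forall>k\<in>K. b k + (P k - w) \<bullet> (x + t *\<^sub>R u) > g x) (at_right (0::real))"
      by (intro eventually_ball_finite assms) auto
    then obtain t :: real where "\<forall>k\<in>K. b k + (P k - w) \<bullet> (x + t *\<^sub>R u) > g x"
      using eventually_happens'[OF trivial_limit_at_right_real] by blast
    then have "g (x + t *\<^sub>R u) > g x" by (intro g_less) auto
    then show False using max[of "x + t *\<^sub>R u"] by simp
  qed
  then show ?thesis by (rule that)
qed

text \<open>A full-dimensional cell determines its point, since hulls at different points overlap in
  a null set, and \<open>K\<close> has only finitely many subsets.\<close>

lemma finite_tcells_cvol_pos:
  assumes "finite K" shows "finite {x. cvol (P ` tcell P b K x) \<noteq> 0}"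
proof (rule finite_imageD)
  show "finite (tcell P b K ` {x. cvol (P ` tcell P b K x) \<noteq> 0})"
    using assms by (intro finite_subset[of "tcell P b K ` _" "Pow K"] image_subsetI PowI tcell_subset) auto
  show "inj_on (tcell P b K) {x. cvol (P ` tcell P b K x) \<noteq> 0}"
  proof (rule inj_onI, rule ccontr)
    fix x y assume *: "tcell P b K x = tcell P b K y" "x \<noteq> y" "x \<in> {x. cvol (P ` tcell P b K x) \<noteq> 0}"
    have "negligible (convex hull (P ` tcell P b K x))"
      using negligible_hull_tcells_Int[OF *(2), of P b K] unfolding *(1) by simp
    then show False
      using *(3) assms by (simp add: cvol_eq_0_iff finite_tcell)
  qed
qed

lemma cvol_eq_sum_tcells:
  assumes fin: "finite K"
  shows "cvol (P ` K) = (\<Sum>x | cvol (P ` tcell P b K x) \<noteq> 0. cvol (P ` tcell P b K x))"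
proof -
  define X where "X = {x. cvol (P ` tcell P b K x) \<noteq> 0}"
  define C where "C = (\<lambda>x. convex hull (P ` tcell P b K x))"
  \<comment> \<open>Infinitely many points may have flat cells, but these cells are among finitely
    many subsets of \<open>K\<close>, so their hulls together remain negligible.\<close>
  define N where "N = frontier (convex hull (P ` K)) \<union> (\<Union>L\<in>{L \<in> Pow K. cvol (P ` L) = 0}. convex hull (P ` L))"
  have finX: "finite X" unfolding X_def using finite_tcells_cvol_pos[OF fin] .
  have "negligible N"
  proof -
    have "negligible (convex hull (P ` L))" if "L \<in> Pow K" "cvol (P ` L) = 0" for L
    proof -
      have "finite (P ` L)" using that fin by (auto intro: finite_subset)
      then show ?thesis using that cvol_eq_0_iff by blast
    qed
    then show ?thesis
      unfolding N_def using fin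
      by (intro negligible_Un negligible_convex_frontier negligible_Union) auto
  qed
  have sub: "\<Union>(C ` X) \<subseteq> convex hull (P ` K)"
    unfolding C_def by (intro UN_least hull_mono image_mono tcell_subset)
  have cov: "convex hull (P ` K) \<subseteq> \<Union>(C ` X) \<union> N"
  proof
    fix w assume w: "w \<in> convex hull (P ` K)"
    show "w \<in> \<Union>(C ` X) \<union> N"
    proof (cases "w \<in> interior (convex hull (P ` K))")
      case True
      then obtain x where x: "w \<in> convex hull (P ` tcell P b K x)"
        using interior_hull_in_tcell_hull[OF fin] by blast
      show ?thesis
      proof (cases "x \<in> X")
        case False
        then have "tcell P b K x \<in> {L \<in> Pow K. cvol (P ` L) = 0}"
          using tcell_subset[of P b K x] by (auto simp: X_def)
        then show ?thesis using x unfolding N_def by blast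
      qed (use x C_def in auto)
    next
      case False
      then show ?thesis using w closure_subset by (auto simp: N_def frontier_def)
    qed
  qed
  have Cm: "C x \<in> lmeasurable" for x
    unfolding C_def using fin by (intro lmeasurable_hull_finite) (auto simp: finite_tcell)
  have "cvol (P ` K) = measure lebesgue (\<Union>(C ` X))"
    unfolding cvol_def
  proof (rule measure_negligible_symdiff)
    show "\<Union> (C ` X) \<in> lmeasurable" using finX Cm by (intro fmeasurable.finite_UN) auto
    show "negligible (\<Union> (C ` X) - convex hull P ` K \<union> (convex hull P ` K - \<Union> (C ` X)))"
      using sub cov by (intro negligible_subset[OF \<open>negligible N\<close>]) auto
  qed
  also have "\<dots> = (\<Sum>x\<in>X. measure lebesgue (C x))"
  proof (rule measure_negligible_finite_Union_image[OF finX])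
    show "pairwise (\<lambda>x y. negligible (C x \<inter> C y)) X"
      unfolding pairwise_def C_def using negligible_hull_tcells_Int by blast
  qed (rule Cm)
  finally show ?thesis by (simp add: X_def C_def cvol_def)
qed

section \<open>Mixed volumes\<close>

definition msum :: "'i set \<Rightarrow> ('i \<Rightarrow> 'a::euclidean_space set) \<Rightarrow> 'a set" where
  "msum S A = (\<lambda>k. \<Sum>i\<in>S. k i) ` PiE S A"

text \<open>Normalized so that dilations of the standard simplex by \<open>d i\<close> have mixed volume \<open>\<Prod>i\<in>N. d i\<close>.\<close>

definition mvol :: "'i set \<Rightarrow> ('i \<Rightarrow> 'a::euclidean_space set) \<Rightarrow> real" where
  "mvol N A = (\<Sum>S\<in>Pow N. (-1) ^ card (N - S) * cvol (msum S A))"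

abbreviation acell :: "('i \<Rightarrow> 'a::euclidean_space \<Rightarrow> real) \<Rightarrow> ('i \<Rightarrow> 'a set) \<Rightarrow> 'a \<Rightarrow> 'i \<Rightarrow> 'a set" where
  "acell a A x \<equiv> (\<lambda>i. tcell (\<lambda>p. p) (a i) (A i) x)"

lemma finite_msum: "finite S \<Longrightarrow> (\<And>i. i \<in> S \<Longrightarrow> finite (A i)) \<Longrightarrow> finite (msum S A)"
  by (auto simp: msum_def intro!: finite_PiE)

lemma msum_cong: "(\<And>i. i \<in> S \<Longrightarrow> A i = B i) \<Longrightarrow> msum S A = msum S B"
  unfolding msum_def using PiE_cong by metis

lemma msum_Un_disjoint:
  assumes "finite S" "finite T" "S \<inter> T = {}"
  shows "msum (S \<union> T) A = (\<Union>u\<in>msum T A. (+) u ` msum S A)"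
proof (intro equalityI subsetI)
  fix z assume "z \<in> msum (S \<union> T) A"
  then obtain k where k: "k \<in> PiE (S \<union> T) A" "z = (\<Sum>i\<in>S \<union> T. k i)" by (auto simp: msum_def)
  then have "z = (\<Sum>i\<in>T. restrict k T i) + (\<Sum>i\<in>S. restrict k S i)"
    using assms by (simp add: sum.union_disjoint)
  moreover have "restrict k T \<in> PiE T A" "restrict k S \<in> PiE S A" using k by auto
  ultimately show "z \<in> (\<Union>u\<in>msum T A. (+) u ` msum S A)" unfolding msum_def by blast
next
  fix z assume "z \<in> (\<Union>u\<in>msum T A. (+) u ` msum S A)"
  then obtain k l where kl: "k \<in> PiE S A" "l \<in> PiE T A" "z = (\<Sum>i\<in>T. l i) + (\<Sum>i\<in>S. k i)"
    by (auto simp: msum_def)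
  define m where "m = (\<lambda>i. if i \<in> S then k i else l i)"
  have "m \<in> PiE (S \<union> T) A" using kl by (auto simp: m_def PiE_def extensional_def)
  moreover have "z = (\<Sum>i\<in>S \<union> T. m i)"
  proof -
    have "(\<Sum>i\<in>S. m i) = (\<Sum>i\<in>S. k i)" by (intro sum.cong) (auto simp: m_def)
    moreover have "(\<Sum>i\<in>T. m i) = (\<Sum>i\<in>T. l i)" using assms(3) by (intro sum.cong) (auto simp: m_def)
    ultimately show ?thesis using assms kl by (simp add: sum.union_disjoint)
  qed
  ultimately show "z \<in> msum (S \<union> T) A" by (auto simp: msum_def)
qed

lemma msum_singleton: "msum {j} A = A j"
proof -
  have "p \<in> msum {j} A" if "p \<in> A j" for p
    using that unfolding msum_def by (intro image_eqI[of _ _ "\<lambda>i\<in>{j}. p"]) auto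
  then show ?thesis by (auto simp: msum_def)
qed

lemma cvol_msum_insert_singleton:
  assumes "finite S" "j \<notin> S" "A j = {c}"
  shows "cvol (msum (insert j S) A) = cvol (msum S A)"
  using msum_Un_disjoint[of S "{j}" A] assms by (simp add: msum_singleton cvol_translation)

lemma cvol_msum_mono:
  assumes "finite N" "S \<subseteq> N" and A: "\<And>i. i \<in> N \<Longrightarrow> finite (A i) \<and> A i \<noteq> {}"
  shows "cvol (msum S A) \<le> cvol (msum N A)"
proof -
  have "PiE (N - S) A \<noteq> {}" using A by (auto simp: PiE_eq_empty_iff)
  then obtain u where u: "u \<in> msum (N - S) A" by (auto simp: msum_def)
  have "finite S" using assms finite_subset by blast
  have "N = S \<union> (N - S)" using assms by auto
  then have "(+) u ` msum S A \<subseteq> msum N A"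
    using msum_Un_disjoint[of S "N - S" A] u assms \<open>finite S\<close> by auto
  then have "cvol ((+) u ` msum S A) \<le> cvol (msum N A)"
    using A assms by (intro cvol_mono finite_msum) (auto intro: hull_inc)
  then show ?thesis by (simp add: cvol_translation)
qed

text \<open>Adding the one-point summand \<open>j\<close> merely translates the sum, so the terms of
  \<open>S\<close> and \<open>insert j S\<close> cancel.\<close>

lemma mvol_singleton_eq_0:
  assumes "finite N" "j \<in> N" "A j = {c}"
  shows "mvol N A = 0"
proof -
  define M where "M = N - {j}"
  have M: "N = insert j M" "j \<notin> M" "finite M" using assms by (auto simp: M_def)
  let ?f = "\<lambda>S. (-1) ^ card (N - S) * cvol (msum S A)"
  have "mvol N A = sum ?f (Pow M) + sum ?f (insert j ` Pow M)"
    unfolding mvol_def M(1) Pow_insert using M by (subst sum.union_disjoint) auto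
  also have "sum ?f (insert j ` Pow M) = (\<Sum>S\<in>Pow M. ?f (insert j S))"
    using M by (subst sum.reindex) (auto simp: inj_on_def)
  also have "(\<Sum>S\<in>Pow M. ?f (insert j S)) = (\<Sum>S\<in>Pow M. - ?f S)"
  proof (intro sum.cong refl)
    fix S assume "S \<in> Pow M"
    then have S: "finite S" "j \<notin> S" "N - S = insert j (M - S)" "N - insert j S = M - S"
      using M finite_subset by auto
    then have "card (N - S) = Suc (card (N - insert j S))" using M by simp
    then show "?f (insert j S) = - ?f S"
      using cvol_msum_insert_singleton[of S j A c] S(1,2) assms(3) by simp
  qed
  finally show ?thesis by (simp add: sum_negf)
qed

text \<open>The height of a tuple is the sum of the heights of its entries, so a minimal tuple is
  minimal in every entry: otherwise replace that entry. Cells of a Minkowski sum are thus sums of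
  cells at the same point.\<close>

lemma tcell_PiE:
  assumes "finite S" and A: "\<And>i. i \<in> S \<Longrightarrow> finite (A i)"
  shows "tcell (\<lambda>k. \<Sum>i\<in>S. k i) (\<lambda>k. \<Sum>i\<in>S. a i (k i)) (PiE S A) x = PiE S (acell a A x)"
proof -
  have eq: "(\<Sum>i\<in>S. a i (k i)) + (\<Sum>i\<in>S. k i) \<bullet> x = (\<Sum>i\<in>S. a i (k i) + k i \<bullet> x)" for k
    by (simp add: sum.distrib inner_sum_left)
  show ?thesis
  proof (intro equalityI subsetI)
    fix k assume k: "k \<in> tcell (\<lambda>k. \<Sum>i\<in>S. k i) (\<lambda>k. \<Sum>i\<in>S. a i (k i)) (PiE S A) x"
    then have kA: "k \<in> PiE S A"
      and min: "\<And>l. l \<in> PiE S A \<Longrightarrow> (\<Sum>i\<in>S. a i (k i) + k i \<bullet> x) \<le> (\<Sum>i\<in>S. a i (l i) + l i \<bullet> x)"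
      by (auto simp: tcell_def eq)
    show "k \<in> PiE S (acell a A x)"
    proof (rule PiE_I)
      fix i assume i: "i \<in> S"
      have "a i (k i) + k i \<bullet> x \<le> a i q + q \<bullet> x" if "q \<in> A i" for q
      proof -
        have "k(i := q) \<in> PiE S A" using kA i that by (auto simp: PiE_def extensional_def Pi_def)
        from min[OF this] have "(\<Sum>j\<in>S - {i}. a j (k j) + k j \<bullet> x) + (a i (k i) + k i \<bullet> x)
           \<le> (\<Sum>j\<in>S - {i}. a j ((k(i:=q)) j) + (k(i:=q)) j \<bullet> x) + (a i q + q \<bullet> x)"
          using assms(1) i by (simp add: sum.remove add.commute)
        moreover have "(\<Sum>j\<in>S - {i}. a j ((k(i:=q)) j) + (k(i:=q)) j \<bullet> x) = (\<Sum>j\<in>S - {i}. a j (k j) + k j \<bullet> x)"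
          by (intro sum.cong) auto
        ultimately show ?thesis by simp
      qed
      then show "k i \<in> acell a A x i" using kA i by (auto simp: tcell_def)
    qed (use kA in auto)
  next
    fix k assume k: "k \<in> PiE S (acell a A x)"
    have "k \<in> PiE S A" using k by (auto simp: PiE_def Pi_def tcell_def)
    moreover have "(\<Sum>i\<in>S. a i (k i) + k i \<bullet> x) \<le> (\<Sum>i\<in>S. a i (l i) + l i \<bullet> x)" if "l \<in> PiE S A" for l
      using k that by (intro sum_mono) (auto simp: PiE_def Pi_def tcell_def)
    ultimately show "k \<in> tcell (\<lambda>k. \<Sum>i\<in>S. k i) (\<lambda>k. \<Sum>i\<in>S. a i (k i)) (PiE S A) x"
      by (auto simp: tcell_def eq)
  qed
qed

context
  fixes N :: "'i set" and A :: "'i \<Rightarrow> 'a::euclidean_space set"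
  assumes finN: "finite N" and A: "\<And>i. i \<in> N \<Longrightarrow> finite (A i) \<and> A i \<noteq> {}"
begin

lemma acell: "i \<in> N \<Longrightarrow> finite (acell a A x i) \<and> acell a A x i \<noteq> {}"
  using A by (simp add: finite_tcell tcell_nonempty)

lemma finite_acells_cvol_pos: "finite {x. cvol (msum N (acell a A x)) \<noteq> 0}"
  using finite_tcells_cvol_pos[of "PiE N A" "\<lambda>k. \<Sum>i\<in>N. k i" "\<lambda>k. \<Sum>i\<in>N. a i (k i)"] finN A
  by (simp add: tcell_PiE msum_def finite_PiE)

text \<open>One \<open>X\<close> must serve every \<open>S\<close>, so that the sums over points and
  over subsets can be swapped. The support for \<open>N\<close> suffices, because volume only grows
  when nonempty summands are added. Leaving \<open>X\<close> free allows further points to be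
  included.\<close>

lemma cvol_msum_eq_sum:
  assumes "S \<subseteq> N" "finite X" and X: "{x. cvol (msum N (acell a A x)) \<noteq> 0} \<subseteq> X"
  shows "cvol (msum S A) = (\<Sum>x\<in>X. cvol (msum S (acell a A x)))"
proof -
  have S: "finite S" "\<And>i. i \<in> S \<Longrightarrow> finite (A i)" using assms A finN finite_subset by auto
  then have "cvol (msum S A) = (\<Sum>x | cvol (msum S (acell a A x)) \<noteq> 0. cvol (msum S (acell a A x)))"
    using cvol_eq_sum_tcells[of "PiE S A" "\<lambda>k. \<Sum>i\<in>S. k i" "\<lambda>k. \<Sum>i\<in>S. a i (k i)"]
    by (simp add: tcell_PiE msum_def finite_PiE)
  also have "\<dots> = (\<Sum>x\<in>X. cvol (msum S (acell a A x)))"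
  proof (rule sum.mono_neutral_left[OF \<open>finite X\<close>])
    show "{x. cvol (msum S (acell a A x)) \<noteq> 0} \<subseteq> X"
    proof clarify
      fix x assume "cvol (msum S (acell a A x)) \<noteq> 0"
      moreover have "cvol (msum S (acell a A x)) \<le> cvol (msum N (acell a A x))"
        using assms(1) by (intro cvol_msum_mono finN acell)
      ultimately have "cvol (msum N (acell a A x)) \<noteq> 0"
        using cvol_nonneg[of "msum S (acell a A x)"] by linarith
      then show "x \<in> X" using X by blast
    qed
  qed auto
  finally show ?thesis .
qed

lemma mvol_eq_sum:
  assumes "finite X" and X: "{x. cvol (msum N (acell a A x)) \<noteq> 0} \<subseteq> X"
  shows "mvol N A = (\<Sum>x\<in>X. mvol N (acell a A x))"
proof -
  have "mvol N A = (\<Sum>S\<in>Pow N. \<Sum>x\<in>X. (-1) ^ card (N - S) * cvol (msum S (acell a A x)))"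
    unfolding mvol_def using cvol_msum_eq_sum[OF _ assms]
    by (intro sum.cong) (auto simp: sum_distrib_left)
  also have "\<dots> = (\<Sum>x\<in>X. mvol N (acell a A x))"
    unfolding mvol_def by (rule sum.swap)
  finally show ?thesis .
qed

end

definition diffs :: "'a::real_vector set \<Rightarrow> 'a set" where
  "diffs C = {p - q |p q. p \<in> C \<and> q \<in> C}"

text \<open>If all differences are orthogonal to a nonzero \<open>u\<close>, the inner product with
  \<open>u\<close> is constant on the sum, whose hull is then flat.\<close>

lemma span_diffs_if_cvol_pos:
  fixes C :: "'i \<Rightarrow> 'a::euclidean_space set"
  assumes "finite S" "\<And>i. i \<in> S \<Longrightarrow> finite (C i)" and pos: "cvol (msum S C) \<noteq> 0"
  shows "span (\<Union>i\<in>S. diffs (C i)) = UNIV"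
proof (rule ccontr)
  assume "span (\<Union>i\<in>S. diffs (C i)) \<noteq> UNIV"
  then have "dim (\<Union>i\<in>S. diffs (C i)) < DIM('a)"
    using dim_eq_full[of "\<Union>i\<in>S. diffs (C i)"] dim_subset_UNIV[of "\<Union>i\<in>S. diffs (C i)"] by linarith
  then obtain u where u: "u \<noteq> 0" "span (\<Union>i\<in>S. diffs (C i)) \<subseteq> {x. u \<bullet> x = 0}"
    using lowdim_subset_hyperplane by blast
  have fin: "finite (msum S C)" using assms by (simp add: finite_msum)
  have "msum S C \<noteq> {}" using pos by (auto simp: cvol_def)
  then obtain k0 where k0: "k0 \<in> PiE S C" by (auto simp: msum_def)
  have "u \<bullet> (\<Sum>i\<in>S. k i) = u \<bullet> (\<Sum>i\<in>S. k0 i)" if "k \<in> PiE S C" for k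
  proof -
    have "u \<bullet> k i = u \<bullet> k0 i" if "i \<in> S" for i
    proof -
      have "k i \<in> C i" "k0 i \<in> C i"
        using PiE_mem[OF \<open>k \<in> PiE S C\<close> \<open>i \<in> S\<close>] PiE_mem[OF k0 \<open>i \<in> S\<close>] .
      then have "k i - k0 i \<in> (\<Union>i\<in>S. diffs (C i))"
        using that by (auto simp: diffs_def intro!: bexI[of _ i])
      then have "k i - k0 i \<in> {x. u \<bullet> x = 0}"
        by (intro subsetD[OF u(2)] span_base)
      then show ?thesis by (simp add: inner_diff_right)
    qed
    then show ?thesis by (simp add: inner_sum_right)
  qed
  then have "convex hull (msum S C) \<subseteq> {x. u \<bullet> x = u \<bullet> (\<Sum>i\<in>S. k0 i)}"
    by (intro hull_minimal convex_hyperplane) (auto simp: msum_def)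
  then have "negligible (convex hull (msum S C))"
    using u(1) negligible_hyperplane negligible_subset by blast
  then show False using pos cvol_eq_0_iff[OF fin] by blast
qed

text \<open>The vanishing coefficient sums are the point: on a cell the lift is a constant minus
  \<open>q \<bullet> x\<close>, and these constants, which depend on the lift and on
  \<open>x\<close>, then drop out.\<close>

lemma span_diffs_expand:
  assumes "finite S" and C: "\<And>i. i \<in> S \<Longrightarrow> finite (C i)" and v: "v \<in> span (\<Union>i\<in>S. diffs (C i))"
  shows "\<exists>c::'i \<Rightarrow> 'a::real_vector \<Rightarrow> real. v = (\<Sum>i\<in>S. \<Sum>q\<in>C i. c i q *\<^sub>R q) \<and> (\<forall>i\<in>S. (\<Sum>q\<in>C i. c i q) = 0)"
    (is "?Q v")
proof -
  have "span (\<Union>i\<in>S. diffs (C i)) \<subseteq> {v. ?Q v}"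
  proof (rule span_minimal)
    show "(\<Union>i\<in>S. diffs (C i)) \<subseteq> {v. ?Q v}"
    proof clarify
      fix i d assume i: "i \<in> S" and "d \<in> diffs (C i)"
      then obtain p q where pq: "p \<in> C i" "q \<in> C i" "d = p - q" by (auto simp: diffs_def)
      define c :: "'i \<Rightarrow> 'a \<Rightarrow> real" where
        "c = (\<lambda>j r. if j = i then (if r = p then 1 else 0) - (if r = q then 1 else 0) else 0)"
      have "(\<Sum>r\<in>C j. c j r *\<^sub>R r) = (if j = i then d else 0)" if "j \<in> S" for j
        using pq C[OF i] by (auto simp: c_def scaleR_diff_left sum_subtractf if_distrib[of "\<lambda>t. t *\<^sub>R _"] sum.delta cong: if_cong)
      then have "d = (\<Sum>j\<in>S. \<Sum>r\<in>C j. c j r *\<^sub>R r)"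
        using i assms(1) by simp
      moreover have "(\<Sum>r\<in>C j. c j r) = 0" if "j \<in> S" for j
        using pq C[OF i] by (cases "j = i") (auto simp: c_def sum_subtractf)
      ultimately show "?Q d" by blast
    qed
    show "subspace {v. ?Q v}"
    proof (rule subspaceI)
      show "0 \<in> {v. ?Q v}" by (auto intro!: exI[of _ "\<lambda>_ _. 0"])
    next
      fix v w assume "v \<in> {v. ?Q v}" "w \<in> {v. ?Q v}"
      then obtain c d where c: "v = (\<Sum>i\<in>S. \<Sum>q\<in>C i. c i q *\<^sub>R q)" "\<forall>i\<in>S. (\<Sum>q\<in>C i. c i q) = 0"
        and d: "w = (\<Sum>i\<in>S. \<Sum>q\<in>C i. d i q *\<^sub>R q)" "\<forall>i\<in>S. (\<Sum>q\<in>C i. d i q) = 0" by auto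
      show "v + w \<in> {v. ?Q v}" using c d
        by (auto intro!: exI[of _ "\<lambda>i q. c i q + d i q"] simp: scaleR_add_left sum.distrib)
    next
      fix t v assume "v \<in> {v. ?Q v}"
      then obtain c where c: "v = (\<Sum>i\<in>S. \<Sum>q\<in>C i. c i q *\<^sub>R q)" "\<forall>i\<in>S. (\<Sum>q\<in>C i. c i q) = 0" by auto
      show "t *\<^sub>R v \<in> {v. ?Q v}" using c
        by (auto intro!: exI[of _ "\<lambda>i q. t * c i q"] simp: scaleR_sum_right simp flip: sum_distrib_left)
    qed
  qed
  then show ?thesis using v by blast
qed

section \<open>Generic lifts and positivity\<close>

text \<open>On the line through \<open>g\<close> in direction \<open>h\<close>, each functional that
  is nonzero at \<open>h\<close> vanishes for one \<open>s\<close> only, and the others keep their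
  nonzero value at \<open>g\<close>; finitely many \<open>s\<close> have to be avoided.\<close>

lemma avoid_zeros_linear:
  fixes L :: "'t \<Rightarrow> ('i \<Rightarrow> 'a \<Rightarrow> real) \<Rightarrow> real"
  assumes "finite T"
    and lin: "\<And>\<tau> a g s. \<tau> \<in> T \<Longrightarrow> L \<tau> (\<lambda>i p. a i p + s * g i p) = L \<tau> a + s * L \<tau> g"
    and nz: "\<And>\<tau>. \<tau> \<in> T \<Longrightarrow> \<exists>g. L \<tau> g \<noteq> 0"
  shows "\<exists>g. \<forall>\<tau>\<in>T. L \<tau> g \<noteq> 0"
  using assms
proof (induction T rule: finite_induct)
  case (insert \<tau>0 T)
  then obtain g where g: "\<forall>\<tau>\<in>T. L \<tau> g \<noteq> 0" by auto
  obtain h where h: "L \<tau>0 h \<noteq> 0" using insert.prems(2) by blast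
  let ?bad = "(\<lambda>\<tau>. - L \<tau> g / L \<tau> h) ` insert \<tau>0 T"
  obtain s where s: "s \<notin> ?bad"
    using ex_new_if_finite[OF infinite_UNIV_char_0, of ?bad] insert.hyps by auto
  have "L \<tau> (\<lambda>i p. g i p + s * h i p) \<noteq> 0" if "\<tau> \<in> insert \<tau>0 T" for \<tau>
  proof (cases "L \<tau> h = 0")
    case True
    then have "\<tau> \<in> T" using that h by auto
    then show ?thesis using True g insert.prems(1)[OF that] by simp
  next
    case False
    have "s \<noteq> - L \<tau> g / L \<tau> h" using s that by blast
    then have "L \<tau> g + s * L \<tau> h \<noteq> 0"
      using False by (auto simp: field_simps eq_neg_iff_add_eq_0)
    then show ?thesis using insert.prems(1)[OF that] by simp
  qed
  then show ?case by blast
qed auto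

text \<open>Cells over \<open>S\<close> whose sum is full-dimensional already fix the point
  \<open>x\<close>; genericity means that no further factor has an accidental tie there.\<close>

definition generic_lift :: "'i set \<Rightarrow> ('i \<Rightarrow> 'a::euclidean_space set) \<Rightarrow> ('i \<Rightarrow> 'a \<Rightarrow> real) \<Rightarrow> bool" where
  "generic_lift N A a \<longleftrightarrow> (\<forall>x. \<forall>S\<subseteq>N. cvol (msum S (acell a A x)) \<noteq> 0 \<longrightarrow> (\<forall>j\<in>N - S. \<exists>c. acell a A x j = {c}))"

text \<open>
  If a cell of the subdivision induced by \<open>S\<close> is full-dimensional and the cell of \<open>j \<notin> S\<close> at the
  same point contains \<open>p \<noteq> p'\<close>, then \<open>p - p'\<close> is a combination of differences inside the cells of \<open>S\<close>,
  and the lift satisfies the corresponding linear relation. There are finitely many such relations.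
\<close>

lemma ex_generic_direction:
  fixes A :: "'i \<Rightarrow> 'a::euclidean_space set"
  assumes finN: "finite N" and A: "\<And>i. i \<in> N \<Longrightarrow> finite (A i) \<and> A i \<noteq> {}"
  shows "\<exists>g. \<forall>a. \<exists>B. finite B \<and> (\<forall>s. s \<notin> B \<longrightarrow> generic_lift N A (\<lambda>i p. a i p + s * g i p))"
proof -
  define T where "T = {(S, C, j, p, p'). S \<in> Pow N \<and> C \<in> PiE N (\<lambda>i. Pow (A i)) \<and> j \<in> N - S \<and>
    p \<in> A j \<and> p' \<in> A j \<and> p \<noteq> p' \<and> p - p' \<in> span (\<Union>i\<in>S. diffs (C i))}"
  have "T \<subseteq> Pow N \<times> PiE N (\<lambda>i. Pow (A i)) \<times> N \<times> (\<Union>i\<in>N. A i) \<times> (\<Union>i\<in>N. A i)"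
    by (auto simp: T_def)
  then have finT: "finite T"
    by (rule finite_subset) (use finN A in \<open>auto intro!: finite_cartesian_product finite_PiE\<close>)
  have "\<exists>c::'i \<Rightarrow> 'a \<Rightarrow> real. p - p' = (\<Sum>i\<in>S. \<Sum>q\<in>C i. c i q *\<^sub>R q) \<and> (\<forall>i\<in>S. (\<Sum>q\<in>C i. c i q) = 0)"
    if "(S, C, j, p, p') \<in> T" for S C j p p'
  proof (rule span_diffs_expand)
    show "finite S" using that finN by (auto simp: T_def intro: finite_subset)
    show "finite (C i)" if i: "i \<in> S" for i
    proof -
      have "i \<in> N" "C i \<in> Pow (A i)"
        using i \<open>(S, C, j, p, p') \<in> T\<close> by (auto simp: T_def dest!: PiE_mem[of C N _ i])
      then show ?thesis using A finite_subset by blast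
    qed
  qed (use that in \<open>auto simp: T_def\<close>)
  then have "\<forall>\<tau>\<in>T. \<exists>c::'i \<Rightarrow> 'a \<Rightarrow> real. (case \<tau> of (S, C, j, p, p') \<Rightarrow>
      p - p' = (\<Sum>i\<in>S. \<Sum>q\<in>C i. c i q *\<^sub>R q) \<and> (\<forall>i\<in>S. (\<Sum>q\<in>C i. c i q) = 0))"
    by auto
  then obtain c :: "_ \<Rightarrow> 'i \<Rightarrow> 'a \<Rightarrow> real" where c: "\<forall>\<tau>\<in>T. (case \<tau> of (S, C, j, p, p') \<Rightarrow>
      p - p' = (\<Sum>i\<in>S. \<Sum>q\<in>C i. c \<tau> i q *\<^sub>R q) \<and> (\<forall>i\<in>S. (\<Sum>q\<in>C i. c \<tau> i q) = 0))"
    by (rule bchoice[THEN exE]) blast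
  define L where "L = (\<lambda>\<tau> (a :: 'i \<Rightarrow> 'a \<Rightarrow> real). case \<tau> of (S, C, j, p, p') \<Rightarrow>
      a j p - a j p' - (\<Sum>i\<in>S. \<Sum>q\<in>C i. c \<tau> i q * a i q))"
  have lin: "L \<tau> (\<lambda>i p. a i p + s * g i p) = L \<tau> a + s * L \<tau> g" for \<tau> a g s
    by (auto simp: L_def algebra_simps sum.distrib sum_distrib_left split: prod.splits)
  have "\<exists>g. L \<tau> g \<noteq> 0" if "\<tau> \<in> T" for \<tau>
  proof -
    obtain S C j p p' where \<tau>: "\<tau> = (S, C, j, p, p')" by (metis prod.exhaust)
    \<comment> \<open>Raising \<open>p\<close> alone is enough: \<open>j\<close> lies outside
      \<open>S\<close>, and \<open>p'\<close> differs from \<open>p\<close>.\<close>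
    have "L \<tau> (\<lambda>i q. if i = j \<and> q = p then 1 else 0) = 1"
      using that unfolding L_def \<tau> T_def by (auto intro!: sum.neutral)
    then show ?thesis by (metis zero_neq_one)
  qed
  then obtain g where g: "\<forall>\<tau>\<in>T. L \<tau> g \<noteq> 0"
    using avoid_zeros_linear[of T L, OF finT lin] by blast
  have gen: "generic_lift N A a" if a: "\<forall>\<tau>\<in>T. L \<tau> a \<noteq> 0" for a
    unfolding generic_lift_def
  proof (intro allI impI ballI, rule ccontr)
    fix x S j assume S: "S \<subseteq> N" "cvol (msum S (acell a A x)) \<noteq> 0" and j: "j \<in> N - S"
      and ns: "\<nexists>c. acell a A x j = {c}"
    have "finite S" using S finN finite_subset by blast
    have fin: "finite (acell a A x i)" "acell a A x i \<noteq> {}" if "i \<in> N" for i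
      using A that by (auto simp: finite_tcell tcell_nonempty)
    obtain p p' where p: "p \<in> acell a A x j" "p' \<in> acell a A x j" "p \<noteq> p'"
      using ns fin(2)[of j] j by blast
    define C where "C = restrict (acell a A x) N"
    have CS: "C i = acell a A x i" if "i \<in> S" for i using that S by (auto simp: C_def)
    have "span (\<Union>i\<in>S. diffs (C i)) = UNIV"
      using span_diffs_if_cvol_pos[OF \<open>finite S\<close> _ S(2)] fin S(1) CS by auto
    moreover have "C \<in> PiE N (\<lambda>i. Pow (A i))"
      unfolding C_def by (intro restrict_PiE_iff[THEN iffD2] ballI PowI tcell_subset)
    moreover have "p \<in> A j" "p' \<in> A j" using p by (auto simp: tcell_def)
    ultimately have \<tau>: "(S, C, j, p, p') \<in> T" using S(1) j p(3) by (simp add: T_def)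
    let ?c = "c (S, C, j, p, p')"
    have c1: "p - p' = (\<Sum>i\<in>S. \<Sum>q\<in>C i. ?c i q *\<^sub>R q)" and c2: "\<And>i. i \<in> S \<Longrightarrow> (\<Sum>q\<in>C i. ?c i q) = 0"
      using bspec[OF c \<tau>] by auto
    have "(\<Sum>q\<in>C i. ?c i q * a i q) = - (\<Sum>q\<in>C i. ?c i q * (q \<bullet> x))" if i: "i \<in> S" for i
    proof -
      obtain r where r: "r \<in> C i" using fin(2)[of i] i CS S by auto
      have "a i q = (a i r + r \<bullet> x) - q \<bullet> x" if "q \<in> C i" for q
        using tcell_eq[of q "\<lambda>p. p" "a i" "A i" x r] that r CS[OF i] by simp
      then have "(\<Sum>q\<in>C i. ?c i q * a i q) = (\<Sum>q\<in>C i. ?c i q * ((a i r + r \<bullet> x) - q \<bullet> x))"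
        by (intro sum.cong) auto
      also have "\<dots> = (\<Sum>q\<in>C i. ?c i q) * (a i r + r \<bullet> x) - (\<Sum>q\<in>C i. ?c i q * (q \<bullet> x))"
        by (simp add: right_diff_distrib sum_subtractf sum_distrib_right)
      finally show ?thesis using c2[OF i] by simp
    qed
    then have "(\<Sum>i\<in>S. \<Sum>q\<in>C i. ?c i q * a i q) = - ((p - p') \<bullet> x)"
      unfolding c1 by (simp add: inner_sum_left sum_negf)
    moreover have "a j p - a j p' = - ((p - p') \<bullet> x)"
      using tcell_eq[OF p(1,2)] by (simp add: inner_diff_left)
    ultimately have "L (S, C, j, p, p') a = 0" by (simp add: L_def)
    then show False using a \<tau> by blast
  qed
  show ?thesis
  proof (intro exI[of _ g] allI)
    fix a
    have "L \<tau> (\<lambda>i p. a i p + s * g i p) \<noteq> 0" if "s \<notin> (\<lambda>\<tau>. - L \<tau> a / L \<tau> g) ` T" "\<tau> \<in> T" for s \<tau>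
    proof -
      have "s \<noteq> - L \<tau> a / L \<tau> g" "L \<tau> g \<noteq> 0" using that g by auto
      then have "L \<tau> a + s * L \<tau> g \<noteq> 0" by (auto simp: field_simps eq_neg_iff_add_eq_0)
      then show ?thesis by (simp add: lin)
    qed
    then show "\<exists>B. finite B \<and> (\<forall>s. s \<notin> B \<longrightarrow> generic_lift N A (\<lambda>i p. a i p + s * g i p))"
      using finT by (intro exI[of _ "(\<lambda>\<tau>. - L \<tau> a / L \<tau> g) ` T"] conjI allI impI gen ballI) auto
  qed
qed

text \<open>\<open>adjoint g 1\<close> represents as an inner product the functional
  \<open>g\<close> prescribed on the vectors \<open>v i\<close>.\<close>

lemma linear_system_solvable:
  fixes v :: "'i \<Rightarrow> 'a::euclidean_space"
  assumes "independent (v ` N)" "inj_on v N"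
  shows "\<exists>y. \<forall>i\<in>N. v i \<bullet> y = \<gamma> i"
proof -
  obtain g :: "'a \<Rightarrow> real" where g: "linear g" "\<forall>b\<in>v ` N. g b = \<gamma> (inv_into N v b)"
    using linear_independent_extend[OF assms(1), of "\<lambda>b. \<gamma> (inv_into N v b)"] by blast
  have "v i \<bullet> adjoint g 1 = \<gamma> i" if "i \<in> N" for i
    using adjoint_works[OF g(1), of "v i" 1] g(2) that assms(2) by simp
  then show ?thesis by blast
qed

context
  fixes N :: "'i set" and A :: "'i \<Rightarrow> 'a::euclidean_space set"
  assumes finN: "finite N" and A: "\<And>i. i \<in> N \<Longrightarrow> finite (A i) \<and> A i \<noteq> {}"
begin

text \<open>Positive volume of the sum over a proper subset would force a one-point cell, so only
  the term \<open>S = N\<close> survives.\<close>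

lemma mvol_acell_generic_mixed:
  assumes gen: "generic_lift N A a" and mixed: "\<And>j. j \<in> N \<Longrightarrow> \<nexists>c. acell a A x j = {c}"
  shows "mvol N (acell a A x) = cvol (msum N (acell a A x))"
proof -
  have zero: "cvol (msum S (acell a A x)) = 0" if S: "S \<in> Pow N - {N}" for S
  proof (rule ccontr)
    assume "cvol (msum S (acell a A x)) \<noteq> 0"
    moreover obtain j where "j \<in> N - S" using S by blast
    ultimately have "\<exists>c. acell a A x j = {c}"
      using gen[unfolded generic_lift_def, rule_format, of S x j] S by simp
    then show False using mixed \<open>j \<in> N - S\<close> by simp
  qed
  have "mvol N (acell a A x) = (\<Sum>S\<in>{N}. (-1) ^ card (N - S) * cvol (msum S (acell a A x)))"
    unfolding mvol_def using finN zero by (intro sum.mono_neutral_right) auto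
  then show ?thesis by simp
qed

lemma mvol_acell_generic_nonneg:
  assumes gen: "generic_lift N A a"
  shows "0 \<le> mvol N (acell a A x)"
proof (cases "\<exists>j\<in>N. \<exists>c. acell a A x j = {c}")
  case True
  then obtain j c where "j \<in> N" "acell a A x j = {c}" by (elim bexE exE)
  then have "mvol N (acell a A x) = 0" by (rule mvol_singleton_eq_0[OF finN])
  then show ?thesis by simp
next
  case False
  then have "mvol N (acell a A x) = cvol (msum N (acell a A x))"
    by (intro mvol_acell_generic_mixed[OF gen]) simp
  then show ?thesis by (simp add: cvol_nonneg)
qed

text \<open>One direction \<open>g\<close> serves all base lifts and all but finitely many
  \<open>s\<close>, so any chosen lift becomes generic under arbitrarily small
  perturbations.\<close>

lemma obtain_generic_direction:
  obtains g where "\<forall>a. \<exists>B. finite B \<and> (\<forall>s. s \<notin> B \<longrightarrow> generic_lift N A (\<lambda>i p. a i p + s * g i p))"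
proof -
  have "\<exists>g. \<forall>a. \<exists>B. finite B \<and> (\<forall>s. s \<notin> B \<longrightarrow> generic_lift N A (\<lambda>i p. a i p + s * g i p))"
    using finN A by (rule ex_generic_direction)
  then show thesis using that by (elim exE)
qed

lemma mvol_nonneg: "0 \<le> mvol N A"
proof -
  obtain g where g: "\<forall>a. \<exists>B. finite B \<and> (\<forall>s. s \<notin> B \<longrightarrow> generic_lift N A (\<lambda>i p. a i p + s * g i p))"
    by (rule obtain_generic_direction)
  obtain B where B: "finite B" "\<forall>s. s \<notin> B \<longrightarrow> generic_lift N A (\<lambda>i p. 0 + s * g i p)"
    using g[rule_format, of "\<lambda>_ _. 0"] by (elim exE conjE)
  obtain s where "s \<notin> B"
    using ex_new_if_finite[OF infinite_UNIV_char_0 B(1)] by (elim exE)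
  then have "generic_lift N A (\<lambda>i p. 0 + s * g i p)" using B(2) by simp
  then obtain a where gen: "generic_lift N A a" by blast
  have "mvol N A = (\<Sum>x | cvol (msum N (acell a A x)) \<noteq> 0. mvol N (acell a A x))"
    by (rule mvol_eq_sum[of N A, OF finN A]) (use finite_acells_cvol_pos[of N A, OF finN A] in auto)
  then show ?thesis using mvol_acell_generic_nonneg[OF gen] by (simp add: sum_nonneg)
qed

text \<open>It suffices to find a generic lift whose cells at one point are exactly the pairs
  \<open>{p i, p' i}\<close>: that point contributes the volume of the parallelepiped, and no point
  contributes negatively.\<close>

lemma mvol_ge_parallelepiped:
  assumes p: "\<And>i. i \<in> N \<Longrightarrow> p i \<in> A i \<and> p' i \<in> A i"
    and indep: "independent ((\<lambda>i. p i - p' i) ` N)" "inj_on (\<lambda>i. p i - p' i) N"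
  shows "cvol (msum N (\<lambda>i. {p i, p' i})) \<le> mvol N A"
proof -
  obtain g where g: "\<forall>a. \<exists>B. finite B \<and> (\<forall>s. s \<notin> B \<longrightarrow> generic_lift N A (\<lambda>i p. a i p + s * g i p))"
    by (rule obtain_generic_direction)
  \<comment> \<open>The cells of this lift at 0 are exactly the pairs; it must become generic
    without losing them.\<close>
  define a0 where "a0 = (\<lambda>i q. if q = p i \<or> q = p' i then 0 else 1 :: real)"
  obtain B where B: "finite B" "\<And>s. s \<notin> B \<Longrightarrow> generic_lift N A (\<lambda>i q. a0 i q + s * g i q)"
    using g[rule_format, of a0] by (elim exE conjE) simp
  \<comment> \<open>The perturbation by \<open>s\<close> times \<open>g\<close> may break the ties
    at 0. Moving the point to \<open>s\<close> times \<open>y\<close> restores them, and for small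
    \<open>s\<close> all other points stay strictly higher.\<close>
  obtain y where y: "\<forall>i\<in>N. (p i - p' i) \<bullet> y = g i (p' i) - g i (p i)"
    using linear_system_solvable[OF indep, of "\<lambda>i. g i (p' i) - g i (p i)"] by blast
  define h where "h = (\<lambda>i q. g i q + q \<bullet> y)"
  have h: "h i (p' i) = h i (p i)" if "i \<in> N" for i
    using y that by (auto simp: h_def inner_diff_left)
  have "eventually (\<lambda>s. \<forall>i\<in>N. \<forall>q\<in>A i. 1 + s * (h i q - h i (p i)) > 0) (at_right (0::real))"
  proof (intro eventually_ball_finite ballI finN)
    fix i q assume "i \<in> N" "q \<in> A i"
    have "((\<lambda>s. 1 + s * (h i q - h i (p i))) \<longlongrightarrow> 1 + 0 * (h i q - h i (p i))) (at_right 0)"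
      by (intro tendsto_intros)
    then show "eventually (\<lambda>s. 1 + s * (h i q - h i (p i)) > 0) (at_right 0)"
      by (rule order_tendstoD) simp
  qed (use A in auto)
  moreover have "eventually (\<lambda>s. \<forall>b\<in>B. s \<noteq> b) (at_right (0::real))"
    by (intro eventually_ball_finite B ballI eventually_neq_at_within)
  moreover have "eventually (\<lambda>s. s > 0) (at_right (0::real))"
    by (rule eventually_at_right_less)
  ultimately have "eventually (\<lambda>s. (\<forall>i\<in>N. \<forall>q\<in>A i. 1 + s * (h i q - h i (p i)) > 0) \<and> s \<notin> B \<and> s > 0) (at_right (0::real))"
    by eventually_elim blast
  then obtain s :: real where s: "\<And>i q. i \<in> N \<Longrightarrow> q \<in> A i \<Longrightarrow> 1 + s * (h i q - h i (p i)) > 0" "s \<notin> B" "s > 0"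
    using eventually_happens'[OF trivial_limit_at_right_real] by blast
  define a where "a = (\<lambda>i q. a0 i q + s * g i q)"
  have gen: "generic_lift N A a" using B s by (simp add: a_def)
  have a: "a i q + s * (q \<bullet> y) = a0 i q + s * h i q" for i q
    by (simp add: a_def h_def algebra_simps)
  have cell: "acell a A (s *\<^sub>R y) i = {p i, p' i}" if i: "i \<in> N" for i
  proof (intro equalityI subsetI)
    fix q assume q: "q \<in> acell a A (s *\<^sub>R y) i"
    then have qA: "q \<in> A i" and le: "a0 i q + s * h i q \<le> a0 i (p i) + s * h i (p i)"
      using p[OF i] by (auto simp: tcell_def a)
    show "q \<in> {p i, p' i}"
    proof (rule ccontr)
      assume "q \<notin> {p i, p' i}"
      then have "a0 i q = 1" "a0 i (p i) = 0" by (auto simp: a0_def)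
      then show False using le s(1)[OF i qA] by (simp add: right_diff_distrib)
    qed
  next
    fix q assume "q \<in> {p i, p' i}"
    then have q: "q \<in> A i" "a0 i q = 0" "h i q = h i (p i)" using p[OF i] h[OF i] by (auto simp: a0_def)
    have "s * h i q \<le> a0 i r + s * h i r" if "r \<in> A i" for r
      using s(1)[OF i that] h[OF i] q(3) by (auto simp: a0_def right_diff_distrib)
    then show "q \<in> acell a A (s *\<^sub>R y) i" using q by (auto simp: tcell_def a)
  qed
  \<comment> \<open>Inserting the point avoids a separate argument that its cells have a sum of
    positive volume.\<close>
  let ?X = "insert (s *\<^sub>R y) {x. cvol (msum N (acell a A x)) \<noteq> 0}"
  have pairs: "msum N (acell a A (s *\<^sub>R y)) = msum N (\<lambda>i. {p i, p' i})" using cell by (rule msum_cong)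
  have ns: "mvol N (acell a A (s *\<^sub>R y)) = cvol (msum N (acell a A (s *\<^sub>R y)))"
  proof (rule mvol_acell_generic_mixed[OF gen])
    fix j assume j: "j \<in> N"
    have "p j - p' j \<in> (\<lambda>i. p i - p' i) ` N" using j by simp
    then have "p j - p' j \<noteq> 0" using indep(1) dependent_zero by metis
    then show "\<nexists>c. acell a A (s *\<^sub>R y) j = {c}" using cell[OF j] by auto
  qed
  have "cvol (msum N (\<lambda>i. {p i, p' i})) = mvol N (acell a A (s *\<^sub>R y))"
    using ns pairs by simp
  also have "\<dots> \<le> (\<Sum>x\<in>?X. mvol N (acell a A x))"
    using finite_acells_cvol_pos[of N A, OF finN A] mvol_acell_generic_nonneg[OF gen] by (intro member_le_sum) auto
  also have "\<dots> = mvol N A"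
    by (rule mvol_eq_sum[of N A, OF finN A, symmetric]) (use finite_acells_cvol_pos[of N A, OF finN A] in auto)
  finally show ?thesis .
qed

end

section \<open>Volumes of parallelepipeds\<close>

definition integral_vec :: "'a::euclidean_space \<Rightarrow> bool" where
  "integral_vec x \<longleftrightarrow> (\<forall>b\<in>Basis. x \<bullet> b \<in> \<int>)"

lemma integral_vec_diff: "integral_vec x \<Longrightarrow> integral_vec y \<Longrightarrow> integral_vec (x - y)"
  by (auto simp: integral_vec_def inner_diff_left)

lemma finite_integral_vec_bounded: "finite {m::'a::euclidean_space. integral_vec m \<and> norm m \<le> R}"
proof -
  let ?K = "{-R..R} \<inter> \<int>"
  have "?K = {x \<in> \<int>. -R \<le> x \<and> x \<le> R}" by auto
  then have fin: "finite ?K" using finite_int_segment[of "-R" R] by simp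
  have "{m::'a. integral_vec m \<and> norm m \<le> R} \<subseteq> (\<lambda>k. \<Sum>b\<in>Basis. k b *\<^sub>R b) ` PiE Basis (\<lambda>_. ?K)"
  proof clarify
    fix m :: 'a assume m: "integral_vec m" "norm m \<le> R"
    have "m = (\<Sum>b\<in>Basis. restrict (\<lambda>b. m \<bullet> b) Basis b *\<^sub>R b)"
      by (simp add: euclidean_representation)
    moreover have "m \<bullet> b \<in> ?K" if "b \<in> Basis" for b
      using m that norm_bound_Basis_le[OF that m(2)] by (auto simp: integral_vec_def abs_le_iff)
    then have "restrict (\<lambda>b. m \<bullet> b) Basis \<in> PiE Basis (\<lambda>_. ?K)" by simp
    ultimately show "m \<in> (\<lambda>k. \<Sum>b\<in>Basis. k b *\<^sub>R b) ` PiE Basis (\<lambda>_. ?K)" by (rule image_eqI)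
  qed
  then show ?thesis by (rule finite_subset) (intro finite_imageI finite_PiE fin finite_Basis)
qed

text \<open>
  The half-open unit cube is covered by the integral translates of the image of the unit cube, and
  moving the pieces back by these translations makes them disjoint subsets of the image.
\<close>

lemma measure_integral_linear_image_cube_ge_1:
  fixes f :: "'a::euclidean_space \<Rightarrow> 'a"
  assumes f: "linear f" "surj f" and int: "\<And>x. integral_vec x \<Longrightarrow> integral_vec (f x)"
  shows "1 \<le> measure lebesgue (f ` cbox 0 One)"
proof -
  define P where "P = f ` cbox 0 One"
  define Q where "Q = {x::'a. \<forall>b\<in>Basis. 0 \<le> x \<bullet> b \<and> x \<bullet> b < 1}"
  have "compact P" unfolding P_def
    by (intro compact_continuous_image linear_continuous_on linear_conv_bounded_linear[THEN iffD1] f compact_cbox)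
  have boxQ: "box 0 One \<subseteq> Q" and Qc: "Q \<subseteq> cbox 0 One"
    by (auto simp: Q_def mem_box less_imp_le)
  have "Q = (\<Inter>b\<in>Basis. {x. b \<bullet> x \<ge> 0} \<inter> {x. b \<bullet> x < 1})"
    by (auto simp: Q_def inner_commute)
  then have "convex Q" by (auto intro!: convex_INT convex_Int convex_halfspace_ge convex_halfspace_lt)
  then have Qm: "Q \<in> lmeasurable"
    by (rule measurable_convex) (rule bounded_subset[OF bounded_cbox Qc])
  have Pm: "P \<in> lmeasurable" using \<open>compact P\<close> by (rule lmeasurable_compact)
  obtain K where K: "\<And>x. x \<in> P \<Longrightarrow> norm x \<le> K" using compact_imp_bounded[OF \<open>compact P\<close>] by (auto simp: bounded_iff)
  obtain K' where K': "\<And>x. x \<in> Q \<Longrightarrow> norm x \<le> K'"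
    using bounded_subset[OF bounded_cbox Qc] by (auto simp: bounded_iff)
  \<comment> \<open>Every translation needed below is a difference of a point of \<open>Q\<close>
    and a point of \<open>P\<close>.\<close>
  define M where "M = {m::'a. integral_vec m \<and> norm m \<le> K + K'}"
  have finM: "finite M" unfolding M_def by (rule finite_integral_vec_bounded)
  define D where "D = (\<lambda>m. P \<inter> (+) (- m) ` Q)"
  have Dm: "D m \<in> lmeasurable" for m
    unfolding D_def by (intro fmeasurable.Int Pm measurable_translation Qm)
  have cov: "box 0 One \<subseteq> (\<Union>m\<in>M. (+) m ` D m)"
  proof
    fix w :: 'a assume "w \<in> box 0 One"
    then have w: "w \<in> Q" using boxQ by blast
    obtain z where z: "w = f z" using f(2) by blast
    define l where "l = (\<Sum>b\<in>Basis. of_int \<lfloor>z \<bullet> b\<rfloor> *\<^sub>R b)"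
    have l: "l \<bullet> b = of_int \<lfloor>z \<bullet> b\<rfloor>" if "b \<in> Basis" for b using that by (simp add: l_def)
    have "integral_vec l" by (simp add: integral_vec_def l)
    have "z - l \<in> cbox 0 One"
      by (auto simp: mem_box l inner_diff_left) (metis add.commute diff_le_eq le_less real_of_int_floor_add_one_ge)
    then have fP: "f (z - l) \<in> P" by (simp add: P_def)
    have w': "w = f l + f (z - l)" using z by (simp add: linear_diff[OF f(1)])
    have "norm (f l) \<le> K + K'"
      using K[OF fP] K'[OF w] norm_triangle_ineq4[of w "f (z - l)"] w' by (simp add: algebra_simps)
    then have "f l \<in> M" using int[OF \<open>integral_vec l\<close>] by (simp add: M_def)
    moreover have "f (z - l) \<in> D (f l)"
      unfolding D_def using fP w w' by (auto intro!: image_eqI[of _ _ w])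
    ultimately show "w \<in> (\<Union>m\<in>M. (+) m ` D m)" using w' by blast
  qed
  \<comment> \<open>\<open>D m\<close> lies in the translate of \<open>Q\<close> by
    \<open>-m\<close>, and different integral translates of a half-open cube are disjoint.\<close>
  have disj: "D m \<inter> D m' = {}" if "m \<in> M" "m' \<in> M" "m \<noteq> m'" for m m'
  proof (rule ccontr)
    assume "D m \<inter> D m' \<noteq> {}"
    then obtain x u u' where "u \<in> Q" "u' \<in> Q" "x = - m + u" "x = - m' + u'"
      unfolding D_def by blast
    then have x: "x + m \<in> Q" "x + m' \<in> Q" by (metis add.commute add_minus_cancel)+
    have "m \<bullet> b = m' \<bullet> b" if b: "b \<in> Basis" for b
    proof -
      have "0 \<le> (x + m) \<bullet> b" "(x + m) \<bullet> b < 1" "0 \<le> (x + m') \<bullet> b" "(x + m') \<bullet> b < 1"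
        using x b by (auto simp: Q_def)
      then have "\<bar>m \<bullet> b - m' \<bullet> b\<bar> < 1" by (simp add: inner_add_left abs_less_iff)
      moreover have "m \<bullet> b - m' \<bullet> b \<in> \<int>" using that \<open>m \<in> M\<close> \<open>m' \<in> M\<close> by (auto simp: M_def integral_vec_def)
      ultimately show ?thesis using Ints_nonzero_abs_less1 by fastforce
    qed
    then show False using euclidean_eqI \<open>m \<noteq> m'\<close> by blast
  qed
  have "1 = measure lebesgue (box 0 One :: 'a set)" by simp
  also have "\<dots> \<le> measure lebesgue (\<Union>m\<in>M. (+) m ` D m)"
    by (intro measure_mono_fmeasurable cov fmeasurable.finite_UN finM measurable_translation Dm) auto
  also have "\<dots> \<le> (\<Sum>m\<in>M. measure lebesgue ((+) m ` D m))"
    by (intro measure_UNION_le finM fmeasurableD measurable_translation Dm)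
  also have "\<dots> = (\<Sum>m\<in>M. measure lebesgue (D m))"
    by (simp add: measure_translation)
  also have "\<dots> = measure lebesgue (\<Union>m\<in>M. D m)"
    using disj by (intro measure_negligible_finite_Union_image[symmetric] finM Dm) (auto simp: pairwise_def)
  also have "\<dots> \<le> measure lebesgue P"
    by (intro measure_mono_fmeasurable Pm fmeasurableD fmeasurable.finite_UN finM Dm) (auto simp: D_def)
  finally show ?thesis by (simp add: P_def)
qed

lemma measure_surj_linear_image_cube_pos:
  fixes f :: "'a::euclidean_space \<Rightarrow> 'a"
  assumes f: "linear f" "surj f"
  shows "0 < measure lebesgue (f ` cbox 0 One)"
proof -
  have "open (f ` box 0 One)" using f by (intro open_surjective_linear_image) auto
  moreover have "f ` box 0 One \<noteq> {}" by (simp add: box_ne_empty)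
  ultimately have "\<not> negligible (f ` cbox 0 One)"
    using open_not_negligible negligible_subset box_subset_cbox image_mono by metis
  moreover have "f ` cbox 0 One \<in> lmeasurable"
    by (intro lmeasurable_compact compact_continuous_image linear_continuous_on linear_conv_bounded_linear[THEN iffD1] f compact_cbox)
  ultimately show ?thesis by (simp add: negligible_iff_measure zero_less_measure_iff)
qed

text \<open>\<open>f\<close> maps the standard basis to the differences \<open>p i - p' i\<close>;
  translated by the sum of the \<open>p' i\<close>, it sends the vertices of the cube into the
  Minkowski sum. The last clause carries integrality, so that positivity and the bound 1 both come
  from this one construction.\<close>

lemma parallelepiped_contains_cube_image:
  fixes p p' :: "'i \<Rightarrow> 'a::euclidean_space"
  assumes finN: "finite N" and card: "card N = DIM('a)" and span: "span ((\<lambda>i. p i - p' i) ` N) = UNIV"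
  shows "\<exists>f::'a \<Rightarrow> 'a. linear f \<and> surj f \<and> measure lebesgue (f ` cbox 0 One) \<le> cvol (msum N (\<lambda>i. {p i, p' i})) \<and>
    ((\<forall>i\<in>N. integral_vec (p i) \<and> integral_vec (p' i)) \<longrightarrow> (\<forall>x. integral_vec x \<longrightarrow> integral_vec (f x)))"
proof -
  obtain \<sigma> where \<sigma>: "bij_betw \<sigma> (Basis::'a set) N"
    using finite_same_card_bij[OF finite_Basis finN] card by auto
  define v where "v = (\<lambda>i. p i - p' i)"
  define f where "f = (\<lambda>x. \<Sum>b\<in>Basis. (x \<bullet> b) *\<^sub>R v (\<sigma> b))"
  have lin: "linear f"
    unfolding f_def by (rule linearI) (auto simp: inner_add_left scaleR_add_left sum.distrib scaleR_sum_right)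
  have "v i \<in> range f" if "i \<in> N" for i
  proof -
    obtain b where b: "b \<in> Basis" "i = \<sigma> b" using \<sigma> \<open>i \<in> N\<close> by (auto simp: bij_betw_def)
    have "f b = (\<Sum>c\<in>Basis. (if c = b then v i else 0))"
      unfolding f_def using b by (intro sum.cong) (auto simp: inner_Basis)
    then have "f b = v i" using b by simp
    then show ?thesis by (metis rangeI)
  qed
  then have "span (v ` N) \<subseteq> range f"
    by (intro span_minimal linear_subspace_image lin subspace_UNIV) auto
  then have surj: "surj f" using span unfolding v_def by blast
  let ?pts = "{x::'a. \<forall>b\<in>Basis. x \<bullet> b = 0 \<or> x \<bullet> b = 1}"
  define c where "c = (\<Sum>i\<in>N. p' i)"
  have sub: "(+) c ` f ` ?pts \<subseteq> msum N (\<lambda>i. {p i, p' i})"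
  proof clarify
    fix x :: 'a assume x: "\<forall>b\<in>Basis. x \<bullet> b = 0 \<or> x \<bullet> b = 1"
    define k where "k = (\<lambda>i\<in>N. p' i + (x \<bullet> inv_into Basis \<sigma> i) *\<^sub>R v i)"
    have inv: "inv_into Basis \<sigma> i \<in> Basis" if "i \<in> N" for i
      using \<sigma> that by (auto simp: bij_betw_def intro!: inv_into_into)
    have "k i \<in> {p i, p' i}" if "i \<in> N" for i
      using bspec[OF x inv[OF that]] that by (auto simp: k_def v_def)
    then have "k \<in> PiE N (\<lambda>i. {p i, p' i})" by (auto simp: k_def)
    moreover have "c + f x = (\<Sum>i\<in>N. k i)"
    proof -
      have "f x = (\<Sum>b\<in>Basis. (x \<bullet> inv_into Basis \<sigma> (\<sigma> b)) *\<^sub>R v (\<sigma> b))"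
        unfolding f_def using \<sigma> by (intro sum.cong) (auto simp: bij_betw_def)
      also have "\<dots> = (\<Sum>i\<in>N. (x \<bullet> inv_into Basis \<sigma> i) *\<^sub>R v i)"
        by (rule sum.reindex_bij_betw[OF \<sigma>])
      finally show ?thesis by (simp add: c_def k_def sum.distrib)
    qed
    ultimately show "c + f x \<in> msum N (\<lambda>i. {p i, p' i})" by (auto simp: msum_def)
  qed
  have fin: "finite (msum N (\<lambda>i. {p i, p' i}))" using finN by (intro finite_msum) auto
  have "measure lebesgue (f ` cbox 0 One) = cvol ((+) c ` f ` ?pts)"
    by (simp add: cvol_translation) (simp add: cvol_def unit_interval_convex_hull convex_hull_linear_image[OF lin])
  also have "\<dots> \<le> cvol (msum N (\<lambda>i. {p i, p' i}))"
    using sub by (intro cvol_mono fin) (auto intro: hull_inc)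
  finally have le: "measure lebesgue (f ` cbox 0 One) \<le> cvol (msum N (\<lambda>i. {p i, p' i}))" .
  have "integral_vec (f x)" if int: "\<forall>i\<in>N. integral_vec (p i) \<and> integral_vec (p' i)" and x: "integral_vec x" for x
  proof -
    have "integral_vec (v (\<sigma> b))" if "b \<in> Basis" for b
      using bspec[OF int, of "\<sigma> b"] \<sigma> that by (auto simp: v_def bij_betw_def intro: integral_vec_diff)
    then show "integral_vec (f x)" using x by (auto simp: integral_vec_def f_def inner_sum_left intro!: Ints_sum Ints_mult)
  qed
  with lin surj le show ?thesis by (intro exI[of _ f] conjI impI allI)
qed

lemma cvol_parallelepiped_pos:
  fixes p p' :: "'i \<Rightarrow> 'a::euclidean_space"
  assumes "finite N" "card N = DIM('a)" "span ((\<lambda>i. p i - p' i) ` N) = UNIV"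
  shows "0 < cvol (msum N (\<lambda>i. {p i, p' i}))"
proof -
  obtain f :: "'a \<Rightarrow> 'a" where f: "linear f" "surj f" "measure lebesgue (f ` cbox 0 One) \<le> cvol (msum N (\<lambda>i. {p i, p' i}))"
    using parallelepiped_contains_cube_image[OF assms] by (elim exE conjE)
  then show ?thesis using measure_surj_linear_image_cube_pos[OF f(1,2)] by linarith
qed

lemma cvol_integral_parallelepiped_ge_1:
  fixes p p' :: "'i \<Rightarrow> 'a::euclidean_space"
  assumes "finite N" "card N = DIM('a)" "span ((\<lambda>i. p i - p' i) ` N) = UNIV"
    and "\<forall>i\<in>N. integral_vec (p i) \<and> integral_vec (p' i)"
  shows "1 \<le> cvol (msum N (\<lambda>i. {p i, p' i}))"
proof -
  obtain f :: "'a \<Rightarrow> 'a" where f: "linear f" "surj f" "measure lebesgue (f ` cbox 0 One) \<le> cvol (msum N (\<lambda>i. {p i, p' i}))"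
    and int: "\<forall>x. integral_vec x \<longrightarrow> integral_vec (f x)"
    using parallelepiped_contains_cube_image[OF assms(1-3)] assms(4) by (elim exE conjE) simp
  then show ?thesis using measure_integral_linear_image_cube_ge_1[OF f(1,2)] by force
qed

section \<open>Independent transversals\<close>

lemma dim_Un_cong: "span A = span B \<Longrightarrow> dim (A \<union> C) = dim (B \<union> C)"
  by (rule span_eq_dim) (simp add: span_Un)

text \<open>Rado's theorem modulo \<open>M\<close>, in the style of Hall's theorem. If a nonempty
  proper \<open>K\<close> satisfies the condition with equality, solve \<open>K\<close> first and
  then the remaining indices modulo its span. Otherwise every such \<open>K\<close> has a surplus of
  1, and any \<open>d\<close> in \<open>D j\<close> outside \<open>span M\<close> may be added to
  \<open>M\<close>.\<close>

lemma rado_hall: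
  fixes D :: "'i \<Rightarrow> 'a::euclidean_space set"
  assumes "finite I" and "\<And>K. K \<subseteq> I \<Longrightarrow> dim M + card K \<le> dim (M \<union> \<Union>(D ` K))"
  shows "\<exists>v. (\<forall>i\<in>I. v i \<in> D i) \<and> dim (M \<union> v ` I) = dim M + card I"
  using assms
proof (induction I arbitrary: M rule: finite_psubset_induct)
  case (psubset I)
  show ?case
  proof (cases "I = {}")
    case False
    show ?thesis
    proof (cases "\<exists>K. K \<subset> I \<and> K \<noteq> {} \<and> dim (M \<union> \<Union>(D ` K)) \<le> dim M + card K")
      case True
      then obtain K where K: "K \<subset> I" "K \<noteq> {}" "dim (M \<union> \<Union>(D ` K)) \<le> dim M + card K" by blast
      have finK: "finite K" using K psubset.hyps(1) finite_subset by blast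
      have tight: "dim (M \<union> \<Union>(D ` K)) = dim M + card K"
        using psubset.prems[OF psubset_imp_subset[OF K(1)]] K(3) by simp
      have "\<exists>v. (\<forall>i\<in>K. v i \<in> D i) \<and> dim (M \<union> v ` K) = dim M + card K"
        using K(1) by (intro psubset.IH psubset.prems) auto
      then obtain v where v: "\<forall>i\<in>K. v i \<in> D i" "dim (M \<union> v ` K) = dim M + card K" by (elim exE conjE)
      have spanK: "span (M \<union> v ` K) = span (M \<union> \<Union>(D ` K))"
        using v tight by (intro dim_eq_span) auto
      have "\<exists>w. (\<forall>i\<in>I - K. w i \<in> D i) \<and>
          dim ((M \<union> \<Union>(D ` K)) \<union> w ` (I - K)) = dim (M \<union> \<Union>(D ` K)) + card (I - K)"
      proof (rule psubset.IH)
        show "I - K \<subset> I" using K by auto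
        fix L assume L: "L \<subseteq> I - K"
        then have "finite L" using psubset.hyps(1) finite_subset by blast
        then have "card (K \<union> L) = card K + card L" using L finK by (intro card_Un_disjoint) auto
        moreover have "M \<union> \<Union>(D ` K) \<union> \<Union>(D ` L) = M \<union> \<Union>(D ` (K \<union> L))" by auto
        moreover have "K \<union> L \<subseteq> I" using L K(1) by auto
        from psubset.prems[OF this] have "dim M + card (K \<union> L) \<le> dim (M \<union> \<Union>(D ` (K \<union> L)))" .
        ultimately show "dim (M \<union> \<Union>(D ` K)) + card L \<le> dim (M \<union> \<Union>(D ` K) \<union> \<Union>(D ` L))"
          using tight by simp
      qed
      then obtain w where w: "\<forall>i\<in>I - K. w i \<in> D i"
        "dim ((M \<union> \<Union>(D ` K)) \<union> w ` (I - K)) = dim (M \<union> \<Union>(D ` K)) + card (I - K)" by (elim exE conjE)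
      define u where "u = (\<lambda>i. if i \<in> K then v i else w i)"
      have "u ` K = v ` K" "u ` (I - K) = w ` (I - K)" by (auto simp: u_def)
      moreover have "I = K \<union> (I - K)" using K(1) by auto
      ultimately have "u ` I = v ` K \<union> w ` (I - K)" by (metis image_Un)
      then have "dim (M \<union> u ` I) = dim ((M \<union> \<Union>(D ` K)) \<union> w ` (I - K))"
        using dim_Un_cong[OF spanK, of "w ` (I - K)"] by (simp add: Un_assoc)
      also have "\<dots> = dim M + card I"
        using w(2) tight K(1) finK psubset.hyps(1) by (simp add: card_Diff_subset card_mono psubset_imp_subset)
      finally show ?thesis using v(1) w(1) by (intro exI[of _ u]) (auto simp: u_def)
    next
      case surplus: False
      obtain j where j: "j \<in> I" using False by blast
      have "\<not> D j \<subseteq> span M"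
      proof
        assume "D j \<subseteq> span M"
        then have "dim (M \<union> D j) \<le> dim M" by (intro dim_mono) (auto simp: span_base)
        then show False using psubset.prems[of "{j}"] j by simp
      qed
      then obtain d where d: "d \<in> D j" "d \<notin> span M" by blast
      have dim1: "dim (insert d M) = dim M + 1" using d by (simp add: dim_insert)
      have "\<exists>v. (\<forall>i\<in>I - {j}. v i \<in> D i) \<and> dim (insert d M \<union> v ` (I - {j})) = dim (insert d M) + card (I - {j})"
      proof (rule psubset.IH)
        show "I - {j} \<subset> I" using j by auto
        fix K assume K: "K \<subseteq> I - {j}"
        show "dim (insert d M) + card K \<le> dim (insert d M \<union> \<Union>(D ` K))"
        proof (cases "K = {}")
          case ne: False
          have "K \<subset> I" using K j by auto
          then have "dim M + card K < dim (M \<union> \<Union>(D ` K))"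
            using surplus ne not_le by blast
          also have "\<dots> \<le> dim (insert d M \<union> \<Union>(D ` K))" by (intro dim_subset) auto
          finally show ?thesis using dim1 by simp
        qed simp
      qed
      then obtain v where v: "\<forall>i\<in>I - {j}. v i \<in> D i"
        "dim (insert d M \<union> v ` (I - {j})) = dim (insert d M) + card (I - {j})" by (elim exE conjE)
      have "(v(j := d)) ` I = insert d (v ` (I - {j}))"
      proof -
        have "(v(j := d)) ` (I - {j}) = v ` (I - {j})" by (intro image_cong) auto
        then show ?thesis using image_insert[of "v(j := d)" j "I - {j}"] j by (simp add: insert_absorb)
      qed
      then have "M \<union> (v(j := d)) ` I = insert d M \<union> v ` (I - {j})" by simp
      moreover have "card I = Suc (card (I - {j}))" using j psubset.hyps(1) by (metis card.remove)
      ultimately have "dim (M \<union> (v(j := d)) ` I) = dim M + card I" using v(2) dim1 by simp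
      then show ?thesis using v(1) d(1) by (intro exI[of _ "v(j := d)"] conjI) auto
    qed
  qed simp
qed

text \<open>An index \<open>j\<close> is dropped while the condition permits it. If it does not, the
  violating \<open>K\<close> satisfies the original condition with equality, since dropping
  \<open>j\<close> lowers \<open>card (I - K)\<close> by exactly 1. Then \<open>s\<close> indices
  are taken from \<open>K\<close> by induction, and all of \<open>I - K\<close> by
  \<open>rado_hall\<close> modulo \<open>K\<close>.\<close>

lemma rado_hall_defect:
  fixes D :: "'i \<Rightarrow> 'a::euclidean_space set"
  assumes "finite I" and "\<And>K. K \<subseteq> I \<Longrightarrow> dim M + t \<le> dim (M \<union> \<Union>(D ` K)) + card (I - K)"
  shows "\<exists>J v. J \<subseteq> I \<and> card J = t \<and> (\<forall>i\<in>J. v i \<in> D i) \<and> dim (M \<union> v ` J) = dim M + t"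
  using assms
proof (induction I arbitrary: t rule: finite_psubset_induct)
  case (psubset I)
  have "t \<le> card I" using psubset.prems[of "{}"] by simp
  show ?case
  proof (cases "t = card I")
    case True
    have "\<exists>v. (\<forall>i\<in>I. v i \<in> D i) \<and> dim (M \<union> v ` I) = dim M + card I"
    proof (rule rado_hall[OF psubset.hyps(1)])
      fix K assume "K \<subseteq> I"
      then show "dim M + card K \<le> dim (M \<union> \<Union>(D ` K))"
        using psubset.prems[of K] True psubset.hyps(1) card_mono[of I K]
        by (simp add: card_Diff_subset finite_subset)
    qed
    then obtain v where "\<forall>i\<in>I. v i \<in> D i" "dim (M \<union> v ` I) = dim M + card I" by (elim exE conjE)
    then show ?thesis using True by (intro exI[of _ I] exI[of _ v]) simp
  next
    case False
    then obtain j where j: "j \<in> I" using \<open>t \<le> card I\<close> by fastforce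
    show ?thesis
    proof (cases "\<forall>K\<subseteq>I - {j}. dim M + t \<le> dim (M \<union> \<Union>(D ` K)) + card (I - {j} - K)")
      case True
      have "\<exists>J v. J \<subseteq> I - {j} \<and> card J = t \<and> (\<forall>i\<in>J. v i \<in> D i) \<and> dim (M \<union> v ` J) = dim M + t"
        using j True by (intro psubset.IH) auto
      then show ?thesis by blast
    next
      case False
      then obtain K where K: "K \<subseteq> I - {j}" "dim (M \<union> \<Union>(D ` K)) + card (I - {j} - K) < dim M + t"
        by (auto simp: not_le)
      have finK: "finite K" using K psubset.hyps(1) finite_subset by blast
      have "card (I - K) = Suc (card (I - {j} - K))"
        using j K(1) psubset.hyps(1) by (subst card.remove[of _ j]) (auto intro!: arg_cong[of _ _ card])
      then have tight: "dim (M \<union> \<Union>(D ` K)) + card (I - K) = dim M + t"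
        using K(2) psubset.prems[OF subset_trans[OF K(1) Diff_subset]] by simp
      define s where "s = dim (M \<union> \<Union>(D ` K)) - dim M"
      have s: "dim (M \<union> \<Union>(D ` K)) = dim M + s" unfolding s_def
        using dim_subset[of M "M \<union> \<Union>(D ` K)"] by simp
      have ts: "t = s + card (I - K)" using tight s by simp
      have "\<exists>J v. J \<subseteq> K \<and> card J = s \<and> (\<forall>i\<in>J. v i \<in> D i) \<and> dim (M \<union> v ` J) = dim M + s"
      proof (rule psubset.IH)
        show "K \<subset> I" using K(1) j by auto
        fix L assume L: "L \<subseteq> K"
        have "I - L = (I - K) \<union> (K - L)" using L K by auto
        then have "card (I - L) = card (I - K) + card (K - L)"
          using psubset.hyps(1) finK card_Un_disjoint[of "I - K" "K - L"] by auto
        moreover have "L \<subseteq> I" using L K(1) by auto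
        from psubset.prems[OF this] have "dim M + t \<le> dim (M \<union> \<Union>(D ` L)) + card (I - L)" .
        ultimately show "dim M + s \<le> dim (M \<union> \<Union>(D ` L)) + card (K - L)"
          using ts by simp
      qed
      then obtain J v where J: "J \<subseteq> K" "card J = s" and v: "\<forall>i\<in>J. v i \<in> D i" "dim (M \<union> v ` J) = dim M + s"
        by (elim exE conjE)
      have spanK: "span (M \<union> v ` J) = span (M \<union> \<Union>(D ` K))"
        using v J s by (intro dim_eq_span) auto
      have "\<exists>w. (\<forall>i\<in>I - K. w i \<in> D i) \<and>
          dim ((M \<union> \<Union>(D ` K)) \<union> w ` (I - K)) = dim (M \<union> \<Union>(D ` K)) + card (I - K)"
      proof (rule rado_hall)
        fix L assume L: "L \<subseteq> I - K"
        have finL: "finite L" using L psubset.hyps(1) finite_subset by blast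
        have "I - K = (I - (K \<union> L)) \<union> L" using L by auto
        then have "card (I - K) = card (I - (K \<union> L)) + card L"
          using psubset.hyps(1) finL card_Un_disjoint[of "I - (K \<union> L)" L] by auto
        moreover have "M \<union> \<Union>(D ` K) \<union> \<Union>(D ` L) = M \<union> \<Union>(D ` (K \<union> L))" by auto
        moreover have "K \<union> L \<subseteq> I" using L K(1) by auto
        from psubset.prems[OF this]
        have "dim M + t \<le> dim (M \<union> \<Union>(D ` (K \<union> L))) + card (I - (K \<union> L))" .
        ultimately show "dim (M \<union> \<Union>(D ` K)) + card L \<le> dim (M \<union> \<Union>(D ` K) \<union> \<Union>(D ` L))"
          using tight by simp
      qed (use psubset.hyps(1) in simp)
      then obtain w where w: "\<forall>i\<in>I - K. w i \<in> D i"
        "dim ((M \<union> \<Union>(D ` K)) \<union> w ` (I - K)) = dim (M \<union> \<Union>(D ` K)) + card (I - K)" by (elim exE conjE)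
      define u where "u = (\<lambda>i. if i \<in> K then v i else w i)"
      have "u ` J = v ` J" "u ` (I - K) = w ` (I - K)" using J(1) by (auto simp: u_def intro!: image_cong)
      then have "u ` (J \<union> (I - K)) = v ` J \<union> w ` (I - K)" by (simp add: image_Un)
      then have "dim (M \<union> u ` (J \<union> (I - K))) = dim ((M \<union> \<Union>(D ` K)) \<union> w ` (I - K))"
        using dim_Un_cong[OF spanK, of "w ` (I - K)"] by (simp add: Un_assoc)
      also have "\<dots> = dim M + t" using w(2) tight by simp
      finally have "dim (M \<union> u ` (J \<union> (I - K))) = dim M + t" .
      moreover have "card (J \<union> (I - K)) = t"
        using J finK psubset.hyps(1) ts by (subst card_Un_disjoint) (auto intro: finite_subset)
      moreover have "\<forall>i\<in>J \<union> (I - K). u i \<in> D i" using v(1) w(1) J(1) by (auto simp: u_def)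
      moreover have "J \<union> (I - K) \<subseteq> I" using J(1) K(1) by auto
      ultimately show ?thesis by (intro exI[of _ "J \<union> (I - K)"] exI[of _ u] conjI)
    qed
  qed
qed

text \<open>These are the bases of full rank in the matroid that the family \<open>D\<close> induces
  on its indices.\<close>

definition transversal_basis :: "('i \<Rightarrow> 'a::euclidean_space set) \<Rightarrow> 'i set \<Rightarrow> bool" where
  "transversal_basis D I \<longleftrightarrow> finite I \<and> card I = DIM('a) \<and> (\<exists>v. (\<forall>i\<in>I. v i \<in> D i) \<and> dim (v ` I) = DIM('a))"

lemma full_dim_image:
  fixes v :: "'i \<Rightarrow> 'a::euclidean_space"
  assumes fin: "finite I" "card I = DIM('a)" and dim: "dim (v ` I) = DIM('a)"
  shows "inj_on v I" "independent (v ` I)" "span (v ` I) = UNIV"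
proof -
  show inj: "inj_on v I"
    using dim fin dim_le_card'[of "v ` I"] card_image_le[of I v] by (intro eq_card_imp_inj_on) auto
  show span: "span (v ` I) = UNIV" using dim dim_eq_full by blast
  show "independent (v ` I)"
    using span dim fin inj by (intro card_le_dim_spanning[of _ UNIV]) (auto simp: card_image)
qed

text \<open>Expand \<open>d\<close> in the basis given by the representatives of \<open>I\<close>;
  any representative with nonzero coefficient can be replaced by \<open>d\<close>.\<close>

lemma transversal_basis_exchange:
  fixes D :: "'i \<Rightarrow> 'a::euclidean_space set"
  assumes I: "transversal_basis D I" and e: "e \<notin> I" "d \<in> D e" "d \<noteq> 0"
  shows "\<exists>j\<in>I. transversal_basis D (insert e (I - {j}))"
proof -
  obtain v where v: "\<forall>i\<in>I. v i \<in> D i" "dim (v ` I) = DIM('a)" and fin: "finite I" "card I = DIM('a)"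
    using I by (auto simp: transversal_basis_def)
  note inj = full_dim_image(1)[OF fin v(2)] and indep = full_dim_image(2)[OF fin v(2)]
  have "d \<in> span (v ` I)" using full_dim_image(3)[OF fin v(2)] by simp
  then obtain c where c: "d = (\<Sum>b\<in>v ` I. c b *\<^sub>R b)"
    unfolding span_finite[OF finite_imageI[OF fin(1)]] by (rule rangeE)
  have "\<exists>b\<in>v ` I. c b \<noteq> 0"
  proof (rule ccontr)
    assume "\<not> ?thesis"
    then have "d = 0" unfolding c by (intro sum.neutral) simp
    then show False using e(3) by simp
  qed
  then obtain b where b: "b \<in> v ` I" "c b \<noteq> 0" by blast
  then obtain j where j: "j \<in> I" "b = v j" by blast
  have img: "v ` (I - {j}) = v ` I - {b}" using inj j by (auto simp: inj_on_def)
  have "d \<notin> span (v ` (I - {j}))"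
  proof
    assume d: "d \<in> span (v ` (I - {j}))"
    have "c b *\<^sub>R b = d - (\<Sum>b\<in>v ` I - {b}. c b *\<^sub>R b)"
      using c b fin by (simp add: sum.remove)
    also have "\<dots> \<in> span (v ` I - {b})"
    proof (rule span_diff)
      show "d \<in> span (v ` I - {b})" using d unfolding img .
    qed (intro span_sum span_scale span_base)
    finally have "(1 / c b) *\<^sub>R c b *\<^sub>R b \<in> span (v ` I - {b})" by (rule span_scale)
    then have "b \<in> span (v ` I - {b})" using b(2) by simp
    then show False using indep b(1) dependent_def by metis
  qed
  moreover have "independent (v ` (I - {j}))" using indep by (rule independent_mono) auto
  then have "dim (v ` (I - {j})) = card I - 1"
    using inj j(1) fin by (simp add: dim_eq_card_independent card_image inj_on_diff card_Diff_singleton)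
  ultimately have "dim (insert d (v ` (I - {j}))) = DIM('a)"
    using fin by (simp add: dim_insert)
  moreover have "(v(e := d)) ` insert e (I - {j}) = insert d (v ` (I - {j}))" using e(1) by auto
  moreover have "card (insert e (I - {j})) = DIM('a)" using fin e(1) j(1) by (simp add: card_Diff_singleton)
  ultimately have "transversal_basis D (insert e (I - {j}))"
    unfolding transversal_basis_def using v(1) e fin
    by (intro conjI exI[of _ "v(e := d)"]) auto
  then show ?thesis using j(1) by blast
qed

text \<open>Besides \<open>I\<close> there is one exchange for each \<open>e\<close> outside
  \<open>I\<close>. These are distinct because \<open>e\<close> is the only new index in its
  set.\<close>

lemma many_transversal_bases:
  fixes D :: "'i \<Rightarrow> 'a::euclidean_space set"
  assumes U: "finite U" "I \<subseteq> U" and I: "transversal_basis D I" and nz: "\<And>e. e \<in> U \<Longrightarrow> \<exists>d\<in>D e. d \<noteq> 0"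
  shows "card U - DIM('a) + 1 \<le> card {J. J \<subseteq> U \<and> transversal_basis D J}"
proof -
  have "\<exists>j. j \<in> I \<and> transversal_basis D (insert e (I - {j}))" if e: "e \<in> U - I" for e
  proof -
    obtain d where "d \<in> D e" "d \<noteq> 0" using nz[of e] e by auto
    then show ?thesis using transversal_basis_exchange[OF I, of e d] e by (simp add: Bex_def)
  qed
  then have "\<forall>e\<in>U - I. \<exists>j. j \<in> I \<and> transversal_basis D (insert e (I - {j}))" by (intro ballI)
  then obtain j where j: "\<forall>e\<in>U - I. j e \<in> I \<and> transversal_basis D (insert e (I - {j e}))"
    by (rule bchoice[THEN exE])
  define g where "g = (\<lambda>e. insert e (I - {j e}))"
  have inj: "inj_on g (U - I)" by (rule inj_onI) (auto simp: g_def)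
  have "insert I (g ` (U - I)) \<subseteq> {J. J \<subseteq> U \<and> transversal_basis D J}"
    using j U I by (auto simp: g_def)
  moreover have "I \<notin> g ` (U - I)" by (auto simp: g_def)
  then have "card (insert I (g ` (U - I))) = card (U - I) + 1"
    using U inj by (simp add: card_image)
  moreover have "card (U - I) = card U - DIM('a)"
    using U I by (simp add: card_Diff_subset transversal_basis_def)
  moreover have "finite {J. J \<subseteq> U \<and> transversal_basis D J}" using U by simp
  ultimately show ?thesis
    using card_mono[of "{J. J \<subseteq> U \<and> transversal_basis D J}" "insert I (g ` (U - I))"] by simp
qed

section \<open>The Bezout bound\<close>

text \<open>Expand the product over \<open>N\<close> of \<open>1 + c i\<close>, where
  \<open>c i\<close> is 0 on \<open>G\<close> and -1 elsewhere: the factors 1 are chosen on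
  \<open>S\<close>, the others on \<open>N - S\<close>.\<close>

lemma sum_supersets_alternating:
  assumes "finite N"
  shows "(\<Sum>S\<in>Pow N. if G \<inter> N \<subseteq> S then (-1) ^ card (N - S) else 0) = (if N \<subseteq> G then 1 else 0 :: real)"
proof -
  have "(\<Prod>i\<in>N - S. if i \<in> G then 0 else -1) = (if G \<inter> N \<subseteq> S then (-1) ^ card (N - S) else 0 :: real)"
    if "S \<in> Pow N" for S
  proof (cases "G \<inter> N \<subseteq> S")
    case True
    then have "(\<Prod>i\<in>N - S. if i \<in> G then 0 else -1) = (\<Prod>i\<in>N - S. -1 :: real)"
      by (intro prod.cong) auto
    then show ?thesis using True by simp
  next
    case False
    then show ?thesis using assms by (auto intro!: prod_zero)
  qed
  then have "(\<Sum>S\<in>Pow N. if G \<inter> N \<subseteq> S then (-1) ^ card (N - S) else 0)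
    = (\<Sum>S\<in>Pow N. (\<Prod>i\<in>S. 1) * (\<Prod>i\<in>N - S. if i \<in> G then 0 else -1 :: real))"
    by (intro sum.cong) auto
  also have "\<dots> = (\<Prod>i\<in>N. 1 + (if i \<in> G then 0 else -1 :: real))"
    using prod_add[OF assms, of "\<lambda>_. 1" "\<lambda>i. if i \<in> G then 0 else -1 :: real"] by simp
  also have "\<dots> = (if N \<subseteq> G then 1 else 0)"
  proof (cases "N \<subseteq> G")
    case True
    then show ?thesis by (auto intro!: prod.neutral)
  next
    case False
    then show ?thesis using assms by (auto intro!: prod_zero)
  qed
  finally show ?thesis .
qed

lemma card_bijections_PiE:
  assumes "finite N"
  shows "card {g \<in> N \<rightarrow>\<^sub>E N. N \<subseteq> g ` N} = fact (card N)"
proof -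
  have "{g \<in> N \<rightarrow>\<^sub>E N. N \<subseteq> g ` N} = {g \<in> N \<rightarrow>\<^sub>E N. inj_on g N}"
  proof (intro Collect_cong conj_cong refl)
    fix g assume "g \<in> N \<rightarrow>\<^sub>E N"
    then have "g ` N \<subseteq> N" by auto
    then show "N \<subseteq> g ` N \<longleftrightarrow> inj_on g N"
      using endo_inj_surj[of N g] finite_surj_inj[of N g] assms by auto
  qed
  also have "card \<dots> = fact (card N)"
    using card_inj_on_subset_funcset[OF assms assms order_refl] by (simp add: fact_prod_rev)
  finally show ?thesis .
qed

text \<open>The power expands into a sum over maps from \<open>N\<close> to \<open>S\<close>. The
  alternating sum retains only the maps onto \<open>N\<close>, which are permutations, and each of
  them contributes the full product.\<close>

lemma polarization:
  fixes d :: "'i \<Rightarrow> real"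
  assumes "finite N"
  shows "(\<Sum>S\<in>Pow N. (-1) ^ card (N - S) * (\<Sum>i\<in>S. d i) ^ card N) = fact (card N) * (\<Prod>i\<in>N. d i)"
proof -
  let ?w = "\<lambda>g. \<Prod>j\<in>N. d (g j)"
  have "(\<Sum>i\<in>S. d i) ^ card N = (\<Sum>g\<in>N \<rightarrow>\<^sub>E N. if g ` N \<inter> N \<subseteq> S then ?w g else 0)" if S: "S \<in> Pow N" for S
  proof -
    have "finite S" using S assms finite_subset by blast
    have "(\<Sum>i\<in>S. d i) ^ card N = (\<Prod>j\<in>N. \<Sum>i\<in>S. d i)" by simp
    also have "\<dots> = (\<Sum>g\<in>N \<rightarrow>\<^sub>E S. ?w g)"
      using assms \<open>finite S\<close> by (intro prod_sum_PiE) auto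
    also have "\<dots> = (\<Sum>g\<in>N \<rightarrow>\<^sub>E N. if g ` N \<inter> N \<subseteq> S then ?w g else 0)"
      using S assms by (intro sum.mono_neutral_cong_left) (auto intro: finite_PiE)
    finally show ?thesis .
  qed
  then have "(\<Sum>S\<in>Pow N. (-1) ^ card (N - S) * (\<Sum>i\<in>S. d i) ^ card N)
    = (\<Sum>S\<in>Pow N. \<Sum>g\<in>N \<rightarrow>\<^sub>E N. (if g ` N \<inter> N \<subseteq> S then (-1) ^ card (N - S) else 0) * ?w g)"
    by (intro sum.cong refl) (auto simp: sum_distrib_left intro!: sum.cong)
  also have "\<dots> = (\<Sum>g\<in>N \<rightarrow>\<^sub>E N. (\<Sum>S\<in>Pow N. if g ` N \<inter> N \<subseteq> S then (-1) ^ card (N - S) else 0) * ?w g)"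
    by (subst sum.swap) (simp add: sum_distrib_right)
  also have "\<dots> = (\<Sum>g\<in>N \<rightarrow>\<^sub>E N. if N \<subseteq> g ` N then ?w g else 0)"
    unfolding sum_supersets_alternating[OF assms] by (intro sum.cong) auto
  also have "\<dots> = (\<Sum>g\<in>{g \<in> N \<rightarrow>\<^sub>E N. N \<subseteq> g ` N}. ?w g)"
    using assms by (intro sum.inter_filter[symmetric] finite_PiE) auto
  also have "\<dots> = (\<Sum>g\<in>{g \<in> N \<rightarrow>\<^sub>E N. N \<subseteq> g ` N}. \<Prod>i\<in>N. d i)"
  proof (intro sum.cong refl)
    fix g assume g: "g \<in> {g \<in> N \<rightarrow>\<^sub>E N. N \<subseteq> g ` N}"
    then have "g ` N = N" by auto
    then have "bij_betw g N N" using assms finite_surj_inj[of N g] by (simp add: bij_betw_def)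
    then show "?w g = (\<Prod>i\<in>N. d i)" by (rule prod.reindex_bij_betw)
  qed
  also have "\<dots> = fact (card N) * (\<Prod>i\<in>N. d i)" using card_bijections_PiE[OF assms] by simp
  finally show ?thesis .
qed

text \<open>Adding the vertices \<open>d i *\<^sub>R b\<close> with the same \<open>b\<close> for
  all \<open>i\<close> yields a vertex of the standard simplex scaled by the sum of the
  \<open>d i\<close>, and no sum of points leaves that simplex.\<close>

lemma cvol_msum_simplices:
  fixes A :: "'i \<Rightarrow> 'a::euclidean_space set" and d :: "'i \<Rightarrow> real"
  assumes fin: "finite S" and d: "\<And>i. i \<in> S \<Longrightarrow> 0 \<le> d i"
    and A: "\<And>i z. i \<in> S \<Longrightarrow> z \<in> A i \<Longrightarrow> (\<forall>b\<in>Basis. 0 \<le> z \<bullet> b) \<and> (\<Sum>b\<in>Basis. z \<bullet> b) \<le> d i"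
    and vertices: "\<And>i. i \<in> S \<Longrightarrow> 0 \<in> A i" "\<And>i b. i \<in> S \<Longrightarrow> b \<in> Basis \<Longrightarrow> d i *\<^sub>R b \<in> A i"
  shows "cvol (msum S A) = (\<Sum>i\<in>S. d i) ^ DIM('a) / fact DIM('a)"
proof -
  define t where "t = (\<Sum>i\<in>S. d i)"
  have "t \<ge> 0" using d by (simp add: t_def sum_nonneg)
  let ?\<Delta> = "convex hull (insert 0 Basis) :: 'a set"
  have "convex hull (msum S A) = (\<lambda>x. t *\<^sub>R x) ` ?\<Delta>"
  proof (intro equalityI hull_minimal)
    show "msum S A \<subseteq> (\<lambda>x. t *\<^sub>R x) ` ?\<Delta>"
    proof
      fix z assume "z \<in> msum S A"
      then obtain k where k: "k \<in> PiE S A" "z = (\<Sum>i\<in>S. k i)" by (auto simp: msum_def)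
      have pos: "0 \<le> z \<bullet> b" if "b \<in> Basis" for b
        unfolding k(2) inner_sum_left using A k(1) that by (intro sum_nonneg) (auto simp: PiE_def Pi_def)
      have "(\<Sum>b\<in>Basis. z \<bullet> b) = (\<Sum>i\<in>S. \<Sum>b\<in>Basis. k i \<bullet> b)"
        unfolding k(2) inner_sum_left by (rule sum.swap)
      also have "\<dots> \<le> t" unfolding t_def using A k(1) by (intro sum_mono) (auto simp: PiE_def Pi_def)
      finally have le: "(\<Sum>b\<in>Basis. z \<bullet> b) \<le> t" .
      show "z \<in> (\<lambda>x. t *\<^sub>R x) ` ?\<Delta>"
      \<comment> \<open>All \<open>d i\<close> may be 0; then no rescaling is possible, but the sum
        consists of the origin alone.\<close>
      proof (cases "t = 0")
        case True
        have "(\<Sum>b\<in>Basis. z \<bullet> b) \<ge> 0" using pos by (rule sum_nonneg)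
        then have "(\<Sum>b\<in>Basis. z \<bullet> b) = 0" using le True by simp
        then have "\<forall>b\<in>Basis. z \<bullet> b = 0"
          using sum_nonneg_eq_0_iff[of Basis "\<lambda>b. z \<bullet> b"] pos by simp
        then have "z = 0" by (subst euclidean_all_zero_iff[symmetric])
        moreover have "0 \<in> ?\<Delta>" by (simp add: hull_inc)
        ultimately show ?thesis by force
      next
        case False
        then have "t > 0" using \<open>t \<ge> 0\<close> by simp
        have "(1 / t) *\<^sub>R z \<in> ?\<Delta>"
          unfolding std_simplex using pos le \<open>t > 0\<close> by (simp flip: sum_divide_distrib)
        then show ?thesis using \<open>t > 0\<close> by (intro image_eqI[of _ _ "(1 / t) *\<^sub>R z"]) auto
      qed
    qed
    show "convex ((\<lambda>x. t *\<^sub>R x) ` ?\<Delta>)" by (intro convex_scaling convex_convex_hull)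
    have "(\<lambda>x. t *\<^sub>R x) ` insert 0 Basis \<subseteq> msum S A"
    proof clarify
      fix b :: 'a assume b: "b \<in> insert 0 Basis"
      define k where "k = (\<lambda>i\<in>S. d i *\<^sub>R b)"
      have "k \<in> PiE S A" using b vertices by (auto simp: k_def)
      moreover have "(\<Sum>i\<in>S. k i) = t *\<^sub>R b" by (simp add: k_def t_def scaleR_sum_left)
      ultimately show "t *\<^sub>R b \<in> msum S A" unfolding msum_def by (metis image_eqI)
    qed
    then show "(\<lambda>x. t *\<^sub>R x) ` ?\<Delta> \<subseteq> convex hull (msum S A)"
      unfolding convex_hull_scaling[symmetric] by (rule hull_mono)
  qed
  then have "cvol (msum S A) = t ^ DIM('a) * measure lebesgue ?\<Delta>"
    using measure_lebesgue_affine[of t 0 ?\<Delta>] \<open>t \<ge> 0\<close> by (simp add: cvol_def)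
  moreover have "?\<Delta> \<in> sets lborel"
    by (simp add: borel_compact finite_imp_compact_convex_hull)
  then have "measure lebesgue ?\<Delta> = 1 / fact DIM('a)"
    using content_std_simplex[where 'a = 'a] by (simp add: measure_completion)
  ultimately show ?thesis by (simp add: t_def)
qed

text \<open>The factorial produced by polarization cancels the one in the volume of the standard
  simplex.\<close>

lemma mvol_simplices:
  fixes A :: "'i \<Rightarrow> 'a::euclidean_space set" and d :: "'i \<Rightarrow> real"
  assumes fin: "finite N" "card N = DIM('a)" and d: "\<And>i. i \<in> N \<Longrightarrow> 0 \<le> d i"
    and A: "\<And>i z. i \<in> N \<Longrightarrow> z \<in> A i \<Longrightarrow> (\<forall>b\<in>Basis. 0 \<le> z \<bullet> b) \<and> (\<Sum>b\<in>Basis. z \<bullet> b) \<le> d i"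
    and vertices: "\<And>i. i \<in> N \<Longrightarrow> 0 \<in> A i" "\<And>i b. i \<in> N \<Longrightarrow> b \<in> Basis \<Longrightarrow> d i *\<^sub>R b \<in> A i"
  shows "mvol N A = (\<Prod>i\<in>N. d i)"
proof -
  have "cvol (msum S A) = (\<Sum>i\<in>S. d i) ^ card N / fact (card N)" if "S \<in> Pow N" for S
    unfolding fin(2) using that d A vertices fin(1)
    by (intro cvol_msum_simplices) (auto intro: finite_subset)
  then have "mvol N A = (\<Sum>S\<in>Pow N. (-1) ^ card (N - S) * (\<Sum>i\<in>S. d i) ^ card N) / fact (card N)"
    unfolding mvol_def sum_divide_distrib by (intro sum.cong) auto
  then show ?thesis using polarization[OF fin(1), of d] by simp
qed

section \<open>Local mixed volumes and transversal points\<close>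

lemma mvol_ge_parallelepiped_transversal:
  fixes A :: "'i \<Rightarrow> 'a::euclidean_space set"
  assumes A: "\<forall>i\<in>N. finite (A i) \<and> A i \<noteq> {}" and trans: "transversal_basis (\<lambda>i. diffs (A i)) N"
  shows "\<exists>p p'. (\<forall>i\<in>N. p i \<in> A i \<and> p' i \<in> A i) \<and> span ((\<lambda>i. p i - p' i) ` N) = UNIV \<and>
    cvol (msum N (\<lambda>i. {p i, p' i})) \<le> mvol N A"
proof -
  obtain v where v: "\<forall>i\<in>N. v i \<in> diffs (A i)" "dim (v ` N) = DIM('a)" and fin: "finite N" "card N = DIM('a)"
    using trans by (auto simp: transversal_basis_def)
  have "\<forall>i\<in>N. \<exists>pp. fst pp \<in> A i \<and> snd pp \<in> A i \<and> v i = fst pp - snd pp"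
    using v(1) by (force simp: diffs_def)
  then obtain pp where pp: "\<forall>i\<in>N. fst (pp i) \<in> A i \<and> snd (pp i) \<in> A i \<and> v i = fst (pp i) - snd (pp i)"
    by (rule bchoice[THEN exE])
  define p where "p = fst \<circ> pp"
  define p' where "p' = snd \<circ> pp"
  have p: "\<And>i. i \<in> N \<Longrightarrow> p i \<in> A i \<and> p' i \<in> A i" using pp by (simp add: p_def p'_def)
  have vp: "v i = p i - p' i" if "i \<in> N" for i using pp that by (simp add: p_def p'_def)
  then have img: "(\<lambda>i. p i - p' i) ` N = v ` N" by (intro image_cong) auto
  have "inj_on (\<lambda>i. p i - p' i) N"
    using full_dim_image(1)[OF fin v(2)] vp by (simp add: inj_on_def)
  then have "cvol (msum N (\<lambda>i. {p i, p' i})) \<le> mvol N A"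
    using fin(1) A p full_dim_image(2)[OF fin v(2)] by (intro mvol_ge_parallelepiped) (auto simp: img)
  then show ?thesis using p full_dim_image(3)[OF fin v(2)] img
    by (intro exI[of _ p] exI[of _ p']) simp
qed

text \<open>A point with a one-point cell contributes 0, and these contributions cannot add up to a
  positive mixed volume. The lift \<open>a\<close> is arbitrary.\<close>

lemma ex_mixed_cell:
  fixes A :: "'i \<Rightarrow> 'a::euclidean_space set"
  assumes A: "\<forall>i\<in>N. finite (A i) \<and> A i \<noteq> {}" and trans: "transversal_basis (\<lambda>i. diffs (A i)) N"
  shows "\<exists>x. \<forall>i\<in>N. \<nexists>c. acell a A x i = {c}"
proof (rule ccontr)
  assume none: "\<nexists>x. \<forall>i\<in>N. \<nexists>c. acell a A x i = {c}"
  have fin: "finite N" "card N = DIM('a)" using trans by (auto simp: transversal_basis_def)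
  obtain p p' :: "'i \<Rightarrow> 'a" where p: "span ((\<lambda>i. p i - p' i) ` N) = UNIV" "cvol (msum N (\<lambda>i. {p i, p' i})) \<le> mvol N A"
    using mvol_ge_parallelepiped_transversal[OF A trans] by (elim exE conjE)
  then have "0 < mvol N A"
    using cvol_parallelepiped_pos[OF fin p(1)] by linarith
  moreover have "mvol N (acell a A x) = 0" for x
  proof -
    have "\<exists>i\<in>N. \<exists>c. acell a A x i = {c}" using none by simp
    then obtain i c where "i \<in> N" "acell a A x i = {c}" by (elim bexE exE)
    then show ?thesis by (rule mvol_singleton_eq_0[OF fin(1)])
  qed
  moreover have "mvol N A = (\<Sum>x\<in>{x. cvol (msum N (acell a A x)) \<noteq> 0}. mvol N (acell a A x))"
    using fin(1) A finite_acells_cvol_pos[of N A a] by (intro mvol_eq_sum) auto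
  ultimately show False by simp
qed

text \<open>In the decomposition of \<open>mvol N A\<close> over points, each point of
  \<open>Z\<close> contributes at least the volume of an integral parallelepiped, and the remaining
  contributions are nonnegative.\<close>

lemma card_transversal_points_le_mvol:
  fixes A :: "'i \<Rightarrow> 'a::euclidean_space set" and a :: "'i \<Rightarrow> 'a \<Rightarrow> real"
  assumes N: "finite N" "card N = DIM('a)"
    and A: "\<forall>i\<in>N. finite (A i) \<and> A i \<noteq> {}"
    and int: "\<forall>i\<in>N. \<forall>p\<in>A i. integral_vec p"
  defines "Z \<equiv> {x. transversal_basis (\<lambda>i. diffs (acell a A x i)) N}"
  shows "finite Z" "real (card Z) \<le> mvol N A"
proof -
  let ?X = "{x. cvol (msum N (acell a A x)) \<noteq> 0}"
  have cell: "\<forall>i\<in>N. finite (acell a A x i) \<and> acell a A x i \<noteq> {}" for x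
    using A by (simp add: finite_tcell tcell_nonempty)
  have finX: "finite ?X" using N(1) A by (intro finite_acells_cvol_pos) auto
  have Z: "x \<in> ?X" "1 \<le> mvol N (acell a A x)" if "x \<in> Z" for x
  proof -
    have "transversal_basis (\<lambda>i. diffs (acell a A x i)) N" using that by (simp add: Z_def)
    from mvol_ge_parallelepiped_transversal[OF cell this] obtain p p' :: "'i \<Rightarrow> 'a" where pA: "\<forall>i\<in>N. p i \<in> acell a A x i \<and> p' i \<in> acell a A x i"
      and p: "span ((\<lambda>i. p i - p' i) ` N) = UNIV" "cvol (msum N (\<lambda>i. {p i, p' i})) \<le> mvol N (acell a A x)"
      by (elim exE conjE)
    have "\<forall>i\<in>N. integral_vec (p i) \<and> integral_vec (p' i)"
      using pA int by (auto simp: tcell_def)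
    then have ge1: "1 \<le> cvol (msum N (\<lambda>i. {p i, p' i}))"
      by (rule cvol_integral_parallelepiped_ge_1[OF N p(1)])
    then show "1 \<le> mvol N (acell a A x)" using p(2) by linarith
    have "msum N (\<lambda>i. {p i, p' i}) \<subseteq> msum N (acell a A x)"
      unfolding msum_def using pA by (intro image_mono PiE_mono) auto
    then have "cvol (msum N (\<lambda>i. {p i, p' i})) \<le> cvol (msum N (acell a A x))"
      using N(1) cell by (intro cvol_mono finite_msum) (auto intro: hull_inc)
    then show "x \<in> ?X" using ge1 by auto
  qed
  have ZX: "Z \<subseteq> ?X" using Z(1) by blast
  then show "finite Z" using finX finite_subset by blast
  have "real (card Z) = (\<Sum>x\<in>Z. 1)" by simp
  also have "\<dots> \<le> (\<Sum>x\<in>Z. mvol N (acell a A x))" using Z(2) by (intro sum_mono)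
  also have "\<dots> \<le> (\<Sum>x\<in>?X. mvol N (acell a A x))"
  proof (rule sum_mono2[OF finX ZX])
    show "0 \<le> mvol N (acell a A x)" for x using N(1) cell[of x] by (intro mvol_nonneg) auto
  qed
  also have "\<dots> = mvol N A" using N(1) A finX by (intro mvol_eq_sum[symmetric]) auto
  finally show "real (card Z) \<le> mvol N A" .
qed

section \<open>Ties at a point and along a direction\<close>

lemma not_singleton_tcell_iff:
  assumes "finite K" "K \<noteq> {}"
  shows "(\<nexists>c. tcell P b K x = {c}) \<longleftrightarrow> (\<exists>k\<in>tcell P b K x. \<exists>l\<in>tcell P b K x. k \<noteq> l)"
proof -
  obtain k where "k \<in> tcell P b K x" using tcell_nonempty[OF assms, of P b x] by auto
  then show ?thesis by (metis singletonD insertI1 subsetI subset_singletonD empty_iff)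
qed

text \<open>Close to \<open>x\<close> only the indices tied at \<open>x\<close> compete, and among
  them the first-order term in direction \<open>u\<close> decides.\<close>

lemma eventually_tcell_direction:
  fixes x u :: "'a::euclidean_space"
  assumes "finite K" and k: "k \<in> tcell P (\<lambda>_. 0) (tcell P b K x) u"
  shows "eventually (\<lambda>t. k \<in> tcell P b K (x + t *\<^sub>R u)) (at_right 0)"
proof -
  have kx: "k \<in> tcell P b K x" and ku: "\<And>l. l \<in> tcell P b K x \<Longrightarrow> P k \<bullet> u \<le> P l \<bullet> u"
    using k by (auto simp: tcell_def[of P "\<lambda>_. 0"])
  have "k \<in> K" using kx by (simp add: tcell_def)
  have "eventually (\<lambda>t. b k + P k \<bullet> (x + t *\<^sub>R u) \<le> b l + P l \<bullet> (x + t *\<^sub>R u)) (at_right 0)" if l: "l \<in> K" for l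
  proof (cases "l \<in> tcell P b K x")
    case True
    show ?thesis using eventually_at_right_less
    proof eventually_elim
      case (elim t)
      then have "t * (P k \<bullet> u) \<le> t * (P l \<bullet> u)" using ku[OF True] by simp
      then show ?case using tcell_eq[OF kx True] by (simp add: inner_add_right)
    qed
  next
    case False
    then obtain m where "m \<in> K" "b m + P m \<bullet> x < b l + P l \<bullet> x"
      using l by (auto simp: tcell_def not_le)
    moreover have "b k + P k \<bullet> x \<le> b m + P m \<bullet> x" using kx \<open>m \<in> K\<close> by (simp add: tcell_def)
    ultimately have less: "(b k + P k \<bullet> (x + 0 *\<^sub>R u)) - (b l + P l \<bullet> (x + 0 *\<^sub>R u)) < 0" by simp
    have "((\<lambda>t. (b k + P k \<bullet> (x + t *\<^sub>R u)) - (b l + P l \<bullet> (x + t *\<^sub>R u))) \<longlongrightarrow>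
      (b k + P k \<bullet> (x + 0 *\<^sub>R u)) - (b l + P l \<bullet> (x + 0 *\<^sub>R u))) (at_right 0)"
      by (intro tendsto_intros)
    from order_tendstoD(2)[OF this less] show ?thesis
      by eventually_elim simp
  qed
  then have "eventually (\<lambda>t. \<forall>l\<in>K. b k + P k \<bullet> (x + t *\<^sub>R u) \<le> b l + P l \<bullet> (x + t *\<^sub>R u)) (at_right 0)"
    by (intro eventually_ball_finite assms(1)) auto
  then show ?thesis by eventually_elim (use \<open>k \<in> K\<close> in \<open>simp add: tcell_def\<close>)
qed

text \<open>Match the head \<open>y\<close>, the largest entry, with an element \<open>z\<close> of
  \<open>M\<close>. If \<open>y\<close> occurs in \<open>M\<close> then \<open>z\<close> must be
  \<open>y\<close>, so that the rest of \<open>M\<close> fits into the tail; otherwise any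
  \<open>z\<close> will do.\<close>

lemma prod_mset_le_prod_take:
  fixes M :: "nat multiset"
  assumes "sorted_wrt (\<ge>) ds" "M \<subseteq># mset ds"
  shows "prod_mset M \<le> prod_list (take (size M) ds)"
  using assms
proof (induction ds arbitrary: M)
  case (Cons y ds)
  show ?case
  proof (cases "M = {#}")
    case False
    have "\<exists>z. z \<in># M \<and> z \<le> y \<and> M - {#z#} \<subseteq># mset ds"
    proof (cases "y \<in># M")
      case True
      then show ?thesis using Cons.prems(2) by (intro exI[of _ y]) (simp add: subset_eq_diff_conv)
    next
      case y: False
      obtain z where z: "z \<in># M" using False by (auto dest: multiset_nonemptyE)
      have "z \<in> set (y # ds)" using mset_subset_eqD[OF Cons.prems(2) z] by simp
      then have "z \<le> y" using Cons.prems(1) by auto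
      moreover have "M \<subseteq># mset ds"
      proof (rule mset_subset_eqI)
        fix a show "count M a \<le> count (mset ds) a"
          using mset_subset_eq_count[OF Cons.prems(2), of a] y
          by (cases "a = y") (auto simp: not_in_iff)
      qed
      then have "M - {#z#} \<subseteq># mset ds" using diff_subset_eq_self subset_mset.order_trans by metis
      ultimately show ?thesis using z by auto
    qed
    then obtain z where z: "z \<in># M" "z \<le> y" "M - {#z#} \<subseteq># mset ds" by (elim exE conjE)
    have M: "M = add_mset z (M - {#z#})" using z(1) by simp
    have "prod_mset M = z * prod_mset (M - {#z#})" by (subst M) simp
    also have "\<dots> \<le> y * prod_list (take (size (M - {#z#})) ds)"
      using Cons.IH[of "M - {#z#}"] Cons.prems(1) z by (intro mult_mono) auto
    also have "\<dots> = prod_list (take (size M) (y # ds))"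
      by (subst (2) M) (simp del: add_mset_remove_trivial_eq)
    finally show ?thesis .
  qed simp
qed simp

lemma prod_le_prod_greatest:
  assumes "J \<subseteq> {..<length ds}" "card J = n"
  shows "(\<Prod>i\<in>J. ds ! i) \<le> prod_greatest n ds"
proof -
  define M where "M = image_mset (\<lambda>i. ds ! i) (mset_set J)"
  have fin: "finite J" using assms(1) finite_subset by blast
  have "mset_set J \<subseteq># mset_set {..<length ds}" using assms(1) by (intro subset_imp_msubset_mset_set) auto
  then have "M \<subseteq># image_mset (\<lambda>i. ds ! i) (mset_set {..<length ds})" unfolding M_def by (rule image_mset_subseteq_mono)
  also have "\<dots> = mset (map (\<lambda>i. ds ! i) [0..<length ds])"
    by (simp add: atLeast0LessThan)
  also have "\<dots> = mset (rev (sort ds))" by (simp add: map_nth)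
  finally have "M \<subseteq># mset (rev (sort ds))" .
  moreover have "sorted_wrt (\<ge>) (rev (sort ds))" by (simp add: sorted_wrt_rev)
  ultimately have "prod_mset M \<le> prod_list (take (size M) (rev (sort ds)))" by (intro prod_mset_le_prod_take)
  moreover have "prod_mset M = (\<Prod>i\<in>J. ds ! i)" by (simp add: M_def prod_unfold_prod_mset)
  moreover have "size M = n" using assms(2) by (simp add: M_def)
  ultimately show ?thesis by (simp add: prod_greatest_def)
qed

section \<open>Isolated solutions\<close>

text \<open>
  Choose a set \<open>K\<close> of indices minimizing Rado's bound, which by assumption is less than the dimension. The
  indices outside \<open>K\<close> then have a transversal independent modulo the differences of \<open>K\<close>. Completing it by
  segments gives a system to which \<open>ex_mixed_cell\<close> applies, and its mixed cell sits at a direction \<open>u\<close>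
  that is orthogonal to the differences of \<open>K\<close>, and nonzero because of the segment \<open>{0, h}\<close> with
  lifts \<open>0\<close> and \<open>-1\<close>.
\<close>

lemma ex_tie_preserving_direction:
  fixes C :: "'i \<Rightarrow> 'a::euclidean_space set"
  assumes U: "finite U" and C: "\<forall>i\<in>U. finite (C i) \<and> C i \<noteq> {} \<and> (\<nexists>c. C i = {c})"
    and no: "\<nexists>I. I \<subseteq> U \<and> transversal_basis (\<lambda>i. diffs (C i)) I"
  shows "\<exists>u. u \<noteq> 0 \<and> (\<forall>i\<in>U. \<nexists>c. tcell (\<lambda>p. p) (\<lambda>_. 0) (C i) u = {c})"
proof -
  define D where "D = (\<lambda>i. diffs (C i))"
  \<comment> \<open>No partial transversal is larger than \<open>\<phi> K\<close>: indices in
    \<open>K\<close> supply at most the dimension of their differences, and every other index at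
    most 1.\<close>
  define \<phi> where "\<phi> = (\<lambda>K. dim (\<Union>(D ` K)) + card (U - K))"
  have "\<exists>K\<subseteq>U. \<phi> K < DIM('a)"
  proof (rule ccontr)
    assume "\<not> ?thesis"
    then have ge: "\<And>K. K \<subseteq> U \<Longrightarrow> DIM('a) \<le> \<phi> K" by (auto simp: not_less)
    have "\<exists>J v. J \<subseteq> U \<and> card J = DIM('a) \<and> (\<forall>i\<in>J. v i \<in> D i) \<and> dim ({} \<union> v ` J) = dim ({} :: 'a set) + DIM('a)"
    proof (rule rado_hall_defect[OF U])
      fix K assume "K \<subseteq> U"
      then show "dim ({} :: 'a set) + DIM('a) \<le> dim ({} \<union> \<Union>(D ` K)) + card (U - K)"
        using ge[of K] by (simp add: \<phi>_def)
    qed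
    then obtain J v where J: "J \<subseteq> U" "card J = DIM('a)" "\<forall>i\<in>J. v i \<in> D i"
      "dim ({} \<union> v ` J) = dim ({} :: 'a set) + DIM('a)" by (elim exE conjE)
    then have "transversal_basis D J"
      unfolding transversal_basis_def using finite_subset[OF J(1) U] by auto
    then show False using no J(1) unfolding D_def by blast
  qed
  then obtain K0 where K0: "K0 \<subseteq> U" "\<phi> K0 < DIM('a)" by blast
  \<comment> \<open>Minimality turns into Rado's condition for the indices outside \<open>K\<close>,
    modulo \<open>M\<close>.\<close>
  obtain K where K: "K \<in> Pow U" "\<And>L. L \<in> Pow U \<Longrightarrow> \<phi> K \<le> \<phi> L"
    using ex_is_arg_min_if_finite[of "Pow U" \<phi>] U by (auto simp: is_arg_min_linorder)
  have \<phi>K: "\<phi> K < DIM('a)" using K(2)[of K0] K0 by simp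
  define M where "M = \<Union>(D ` K)"
  have "\<exists>w. (\<forall>i\<in>U - K. w i \<in> D i) \<and> dim (M \<union> w ` (U - K)) = dim M + card (U - K)"
  proof (rule rado_hall)
    fix L assume L: "L \<subseteq> U - K"
    have "finite L" using L U finite_subset by blast
    have "U - K = (U - (K \<union> L)) \<union> L" using L by auto
    then have "card (U - K) = card (U - (K \<union> L)) + card L"
      using U \<open>finite L\<close> card_Un_disjoint[of "U - (K \<union> L)" L] by auto
    moreover have "K \<union> L \<in> Pow U" using K(1) L by auto
    then have "\<phi> K \<le> \<phi> (K \<union> L)" by (rule K(2))
    moreover have "M \<union> \<Union>(D ` L) = \<Union>(D ` (K \<union> L))" by (auto simp: M_def)
    ultimately show "dim M + card L \<le> dim (M \<union> \<Union>(D ` L))" by (simp add: \<phi>_def M_def)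
  qed (use U in simp)
  then obtain w where w: "\<forall>i\<in>U - K. w i \<in> D i" "dim (M \<union> w ` (U - K)) = dim M + card (U - K)"
    by (elim exE conjE)
  obtain B where B: "B \<subseteq> M" "independent B" "M \<subseteq> span B" "card B = dim M"
    using basis_exists[of M] by blast
  define E where "E = B \<union> w ` (U - K)"
  have finB: "finite B" using B(2) by (rule independent_imp_finite)
  have finE: "finite E" using finB U by (simp add: E_def)
  have spB: "span B = span M" using B by (metis span_minimal span_mono subspace_span subset_antisym)
  have dimE: "dim E = card B + card (U - K)"
    unfolding E_def dim_Un_cong[OF spB] using w(2) B(4) by simp
  have cardE: "card E \<le> card B + card (w ` (U - K))" "card (w ` (U - K)) \<le> card (U - K)"
    unfolding E_def using U by (auto intro: card_Un_le card_image_le)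
  have "dim E \<le> card E" using finE by (rule dim_le_card')
  then have cards: "card E = dim E" "card (w ` (U - K)) = card (U - K)" "card E = card B + card (w ` (U - K))"
    using dimE cardE by auto
  \<comment> \<open>Injectivity and disjointness let each vector of \<open>E\<close> stand for one
    factor only, so the new system can be indexed by vectors.\<close>
  have inj: "inj_on w (U - K)" using cards(2) U by (intro eq_card_imp_inj_on) auto
  have disj: "B \<inter> w ` (U - K) = {}"
    using cards(3) card_Un_Int[OF finB, of "w ` (U - K)"] U finB by (simp add: E_def)
  have indE: "independent E"
    by (rule card_le_dim_spanning[of E "span E"]) (use cards finE in \<open>auto simp: span_base\<close>)
  define S where "S = extend_basis E"
  have S: "E \<subseteq> S" "independent S" "span S = UNIV"
    unfolding S_def using extend_basis_superset[OF indE] independent_extend_basis[OF indE] span_extend_basis[OF indE] .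
  have finS: "finite S" using S(2) by (rule independent_imp_finite)
  have dimS: "dim S = DIM('a)" using S(3) dim_eq_full by blast
  then have cardS: "card S = DIM('a)" using S(2) by (simp add: dim_eq_card_independent)
  \<comment> \<open>\<open>card E\<close> is \<open>\<phi> K\<close>, so a basis extending
    \<open>E\<close> contains a further vector \<open>h\<close>.\<close>
  have "card E < card S" using cards(1) dimE B(4) \<phi>K cardS by (simp add: \<phi>_def M_def)
  then obtain h where h: "h \<in> S" "h \<notin> E" using finE card_mono[OF finE, of S] by (auto simp: not_le)
  have S0: "b \<noteq> 0" if "b \<in> S" for b using S(2) that dependent_zero by metis
  let ?W = "w ` (U - K)"
  define F where "F = (\<lambda>b. if b \<in> ?W then C (inv_into (U - K) w b) else {0, b})"
  \<comment> \<open>For \<open>b\<close> in \<open>B\<close> a tie between 0 and \<open>b\<close>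
    means \<open>b \<bullet> u = 0\<close>. For \<open>b\<close> outside \<open>E\<close> it means
    \<open>b \<bullet> u = 1\<close>, which rules out \<open>u = 0\<close>. The factors
    \<open>C i\<close> keep lift 0, so their cells at \<open>u\<close> are faces in direction
    \<open>u\<close>.\<close>
  define a where "a = (\<lambda>b q. if b \<in> E then 0 else if q = b then -1 else 0 :: real)"
  have F: "\<forall>b\<in>S. finite (F b) \<and> F b \<noteq> {}"
  proof
    fix b assume "b \<in> S"
    show "finite (F b) \<and> F b \<noteq> {}"
    proof (cases "b \<in> ?W")
      case True
      then have "inv_into (U - K) w b \<in> U - K" by (rule inv_into_into)
      then show ?thesis using C True by (simp add: F_def)
    qed (simp add: F_def)
  qed
  have "b \<in> diffs (F b)" if "b \<in> S" for b
  proof (cases "b \<in> ?W")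
    case True
    then obtain i where i: "i \<in> U - K" "b = w i" by blast
    then show ?thesis using w(1) inj by (auto simp: F_def D_def)
  next
    case False
    then show ?thesis unfolding diffs_def F_def by (intro CollectI exI[of _ b] exI[of _ "0::'a"]) simp
  qed
  then have "transversal_basis (\<lambda>b. diffs (F b)) S"
    unfolding transversal_basis_def using finS cardS dimS by (intro conjI exI[of _ id]) auto
  from ex_mixed_cell[OF F this, of a] obtain u where u: "\<forall>b\<in>S. \<nexists>c. acell a F u b = {c}" by (elim exE)
  have seg: "a b 0 = a b b + b \<bullet> u" if b: "b \<in> S" "b \<notin> ?W" for b
  proof (rule ccontr)
    assume ne: "a b 0 \<noteq> a b b + b \<bullet> u"
    have "acell a F u b = {if a b 0 < a b b + b \<bullet> u then 0 else b}"
      using ne b S0[OF b(1)] by (auto simp: F_def tcell_def)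
    then show False using u b(1) by blast
  qed
  have "h \<bullet> u = 1" using seg[of h] h S0[OF h(1)] by (auto simp: a_def E_def)
  then have "u \<noteq> 0" by auto
  have orthB: "b \<bullet> u = 0" if "b \<in> B" for b
    using seg[of b] that disj S(1) by (auto simp: a_def E_def)
  have orth: "m \<bullet> u = 0" if "m \<in> M" for m
  proof -
    have "m \<in> span B" using that B(3) by blast
    moreover have "span B \<subseteq> {z. u \<bullet> z = 0}"
      using orthB by (intro span_minimal subspace_hyperplane) (auto simp: inner_commute)
    ultimately show ?thesis by (auto simp: inner_commute)
  qed
  have "\<nexists>c. tcell (\<lambda>p. p) (\<lambda>_. 0) (C i) u = {c}" if i: "i \<in> U" for i
  proof (cases "i \<in> K")
    case True
    \<comment> \<open>For \<open>i\<close> in \<open>K\<close> the differences are orthogonal to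
      \<open>u\<close>, hence all of \<open>C i\<close> stays tied.\<close>
    have le: "p \<bullet> u \<le> q \<bullet> u" if "p \<in> C i" "q \<in> C i" for p q
    proof -
      have "p - q \<in> M" using that True by (auto simp: M_def D_def diffs_def)
      then show ?thesis using orth[of "p - q"] by (simp add: inner_diff_left)
    qed
    have "tcell (\<lambda>p. p) (\<lambda>_. 0) (C i) u = C i" unfolding tcell_def using le by auto
    then show ?thesis using C i by simp
  next
    case False
    then have iUK: "i \<in> U - K" using i by simp
    then have wi: "w i \<in> E" "w i \<in> S" using S(1) by (auto simp: E_def)
    have "F (w i) = C i" using iUK inj by (simp add: F_def)
    moreover have "a (w i) = (\<lambda>_. 0)" using wi by (simp add: a_def)
    ultimately show ?thesis using bspec[OF u wi(2)] by simp
  qed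
  then show ?thesis using \<open>u \<noteq> 0\<close> by blast
qed

text \<open>Without a transversal there is a direction \<open>u\<close> in which every polynomial
  keeps a tie, and short steps along it reach solutions arbitrarily close to
  \<open>x\<close>.\<close>

lemma isolated_tie_transversal:
  fixes A :: "'i \<Rightarrow> 'a::euclidean_space set"
  assumes U: "finite U" and A: "\<forall>i\<in>U. finite (A i) \<and> A i \<noteq> {}"
    and iso: "x isolated_in {x. \<forall>i\<in>U. \<nexists>c. acell a A x i = {c}}"
  shows "\<exists>I. I \<subseteq> U \<and> transversal_basis (\<lambda>i. diffs (acell a A x i)) I"
proof (rule ccontr)
  assume no: "\<not> ?thesis"
  let ?S = "{x. \<forall>i\<in>U. \<nexists>c. acell a A x i = {c}}"
  obtain e where xS: "x \<in> ?S" and e: "e > 0" "\<forall>y\<in>?S. dist x y < e \<longrightarrow> y = x"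
    using iso unfolding isolated_in_dist_Ex_iff by (elim exE conjE)
  have cell: "finite (acell a A x i) \<and> acell a A x i \<noteq> {}" if "i \<in> U" for i
    using A that by (simp add: finite_tcell tcell_nonempty)
  have "\<exists>u. u \<noteq> 0 \<and> (\<forall>i\<in>U. \<nexists>c. tcell (\<lambda>p. p) (\<lambda>_. 0) (acell a A x i) u = {c})"
    using cell xS by (intro ex_tie_preserving_direction U no) auto
  then obtain u where u: "u \<noteq> 0" "\<forall>i\<in>U. \<nexists>c. tcell (\<lambda>p. p) (\<lambda>_. 0) (acell a A x i) u = {c}"
    by (elim exE conjE)
  have "eventually (\<lambda>t. \<nexists>c. acell a A (x + t *\<^sub>R u) i = {c}) (at_right 0)" if i: "i \<in> U" for i
  proof -
    have fA: "finite (A i)" "A i \<noteq> {}" using A i by auto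
    obtain p q where pq: "p \<in> tcell (\<lambda>p. p) (\<lambda>_. 0) (acell a A x i) u"
      "q \<in> tcell (\<lambda>p. p) (\<lambda>_. 0) (acell a A x i) u" "p \<noteq> q"
      using bspec[OF u(2) i] cell[OF i] unfolding not_singleton_tcell_iff[OF conjunct1[OF cell[OF i]] conjunct2[OF cell[OF i]]]
      by (elim bexE)
    from eventually_tcell_direction[OF fA(1) pq(1)] eventually_tcell_direction[OF fA(1) pq(2)]
    show ?thesis by eventually_elim (use pq(3) in auto)
  qed
  then have "eventually (\<lambda>t. \<forall>i\<in>U. \<nexists>c. acell a A (x + t *\<^sub>R u) i = {c}) (at_right (0::real))"
    by (intro eventually_ball_finite U ballI)
  moreover have "eventually (\<lambda>t. t < e / norm u) (at_right (0::real))"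
    using e(1) u(1) by (intro order_tendstoD(2)[OF tendsto_ident_at]) auto
  moreover have "eventually (\<lambda>t. t > 0) (at_right (0::real))" by (rule eventually_at_right_less)
  ultimately have "eventually (\<lambda>t. x + t *\<^sub>R u \<in> ?S \<and> t < e / norm u \<and> t > 0) (at_right (0::real))"
    by eventually_elim simp
  then obtain t :: real where t: "x + t *\<^sub>R u \<in> ?S" "t < e / norm u" "t > 0"
    using eventually_happens'[OF trivial_limit_at_right_real] by blast
  have "dist x (x + t *\<^sub>R u) < e" using t(2,3) u(1) by (simp add: dist_norm field_simps)
  then have "x + t *\<^sub>R u = x" using e(2) t(1) by blast
  then show False using t(3) u(1) by simp
qed

section \<open>Tropical polynomials as lifted point configurations\<close>

definition real_vec :: "nat ^ 'n \<Rightarrow> real ^ 'n::finite" where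
  "real_vec i = (\<chi> v. real (i $ v))"

definition newton_points :: "'n::finite tpoly \<Rightarrow> (real ^ 'n) set" where
  "newton_points f = real_vec ` dom f"

definition lift :: "'n::finite tpoly \<Rightarrow> real ^ 'n \<Rightarrow> real" where
  "lift f p = the (f (inv real_vec p))"

lemma inj_real_vec: "inj real_vec"
  by (auto simp: inj_def real_vec_def vec_eq_iff)

lemma lift_real_vec [simp]: "lift f (real_vec i) = the (f i)"
  by (simp add: lift_def inv_f_f[OF inj_real_vec])

lemma tmonom_eq_inner: "tmonom c i x = c + real_vec i \<bullet> x"
  by (simp add: tmonom_def real_vec_def inner_vec_def)

lemma tropical_poly_newton_points:
  assumes "tropical_poly f" shows "finite (newton_points f)" "newton_points f \<noteq> {}"
  using assms by (auto simp: tropical_poly_def newton_points_def)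

lemma tcell_image: "tcell (\<lambda>p. p) a (g ` K) x = g ` tcell g (\<lambda>k. a (g k)) K x"
  by (auto simp: tcell_def)

text \<open>Cells are nonempty and \<open>real_vec\<close> is injective, so two monomials attaining
  the minimum are the same as a cell with more than one point.\<close>

lemma tropical_zero_iff:
  assumes f: "tropical_poly f"
  shows "tropical_zero f x \<longleftrightarrow> (\<nexists>c. tcell (\<lambda>p. p) (lift f) (newton_points f) x = {c})"
proof -
  have fin: "finite (dom f)" "dom f \<noteq> {}" using f by (auto simp: tropical_poly_def)
  have min: "tmonom (the (f i)) i x = teval f x \<longleftrightarrow> (\<forall>j\<in>dom f. tmonom (the (f i)) i x \<le> tmonom (the (f j)) j x)"
    if "i \<in> dom f" for i
    unfolding teval_def
  proof
    assume "tmonom (the (f i)) i x = Min ((\<lambda>i. tmonom (the (f i)) i x) ` dom f)"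
    then show "\<forall>j\<in>dom f. tmonom (the (f i)) i x \<le> tmonom (the (f j)) j x" using fin by simp
  next
    assume "\<forall>j\<in>dom f. tmonom (the (f i)) i x \<le> tmonom (the (f j)) j x"
    then show "tmonom (the (f i)) i x = Min ((\<lambda>i. tmonom (the (f i)) i x) ` dom f)"
      using fin that by (intro Min_eqI[symmetric]) auto
  qed
  have cell: "tcell (\<lambda>p. p) (lift f) (newton_points f) x
    = real_vec ` {i \<in> dom f. tmonom (the (f i)) i x = teval f x}"
    unfolding newton_points_def tcell_image
    unfolding tcell_def lift_real_vec
    by (intro arg_cong[of _ _ "image real_vec"] Collect_cong conj_cong refl)
      (use min in \<open>simp only: tmonom_eq_inner\<close>)
  have "tropical_zero f x \<longleftrightarrow> (\<exists>p\<in>tcell (\<lambda>p. p) (lift f) (newton_points f) x.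
      \<exists>q\<in>tcell (\<lambda>p. p) (lift f) (newton_points f) x. p \<noteq> q)"
    unfolding cell tropical_zero_def by (auto simp: inj_eq[OF inj_real_vec] simp del: domIff)
  then show ?thesis
    using not_singleton_tcell_iff[OF tropical_poly_newton_points[OF f], of "\<lambda>p. p" "lift f" x] by simp
qed

lemma integral_vec_real_vec: "integral_vec (real_vec i)"
  by (auto simp: integral_vec_def real_vec_def Basis_vec_def inner_axis)

text \<open>Finite coefficients place the origin and the multiples of the basis vectors among the
  exponents, which makes the Newton polytope a full dilated simplex and its degree the dilation
  factor.\<close>

lemma newton_points_simplex:
  assumes f: "tropical_poly f" "finite_coeffs f"
  shows "\<And>z. z \<in> newton_points f \<Longrightarrow> (\<forall>b\<in>Basis. 0 \<le> z \<bullet> b) \<and> (\<Sum>b\<in>Basis. z \<bullet> b) \<le> real (tdegree f)"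
    and "0 \<in> newton_points f"
    and "\<And>b. b \<in> Basis \<Longrightarrow> real (tdegree f) *\<^sub>R b \<in> newton_points f"
proof -
  fix z assume "z \<in> newton_points f"
  then obtain i where i: "i \<in> dom f" "z = real_vec i" by (auto simp: newton_points_def)
  have "(\<Sum>b\<in>Basis. z \<bullet> b) = z \<bullet> 1" by (simp add: Cart_1 inner_sum_right)
  also have "\<dots> = real (monom_tdegree i)" by (simp add: inner_vec_def i(2) real_vec_def monom_tdegree_def)
  also have "\<dots> \<le> real (tdegree f)"
    using f(1) i(1) unfolding tdegree_def tropical_poly_def by (intro of_nat_mono Max_ge) auto
  finally show "(\<forall>b\<in>Basis. 0 \<le> z \<bullet> b) \<and> (\<Sum>b\<in>Basis. z \<bullet> b) \<le> real (tdegree f)"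
    by (auto simp: i(2) real_vec_def Basis_vec_def inner_axis)
next
  have "0 \<in> {i. monom_tdegree i \<le> tdegree f}" by (simp add: monom_tdegree_def)
  then have "0 \<in> dom f" using f(2) unfolding finite_coeffs_def by blast
  moreover have "real_vec 0 = 0" by (simp add: real_vec_def vec_eq_iff)
  ultimately show "0 \<in> newton_points f" unfolding newton_points_def by (metis image_eqI)
next
  fix b :: "real ^ 'a" assume "b \<in> Basis"
  then obtain v where b: "b = axis v 1" by (auto simp: Basis_vec_def)
  have "monom_tdegree (axis v (tdegree f)) = tdegree f"
    by (simp add: monom_tdegree_def axis_def if_distrib cong: if_cong)
  then have "axis v (tdegree f) \<in> {i. monom_tdegree i \<le> tdegree f}" by simp
  then have "axis v (tdegree f) \<in> dom f" using f(2) unfolding finite_coeffs_def by blast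
  moreover have "real_vec (axis v (tdegree f)) = real (tdegree f) *\<^sub>R b"
    by (simp add: real_vec_def b axis_def vec_eq_iff)
  ultimately show "real (tdegree f) *\<^sub>R b \<in> newton_points f" unfolding newton_points_def by (metis image_eqI)
qed

text \<open>Count pairs of \<open>x\<close> and a member of \<open>G x\<close>. Since
  \<open>m\<close> is positive, every \<open>x\<close> lies in some fibre, so finiteness of
  \<open>Z\<close> follows from that of the fibres.\<close>

lemma card_le_by_multicount:
  fixes G :: "'x \<Rightarrow> 'j set"
  assumes J: "finite \<J>" and G: "\<And>x. x \<in> Z \<Longrightarrow> G x \<subseteq> \<J> \<and> m \<le> card (G x)" and "0 < m"
    and fib: "\<And>j. j \<in> \<J> \<Longrightarrow> finite {x \<in> Z. j \<in> G x} \<and> card {x \<in> Z. j \<in> G x} \<le> D"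
  shows "finite Z \<and> card Z * m \<le> card \<J> * D"
proof -
  have "Z \<subseteq> (\<Union>j\<in>\<J>. {x \<in> Z. j \<in> G x})"
  proof
    fix x assume x: "x \<in> Z"
    then have "G x \<noteq> {}" using G[of x] \<open>0 < m\<close> by auto
    then show "x \<in> (\<Union>j\<in>\<J>. {x \<in> Z. j \<in> G x})" using x G[of x] by auto
  qed
  moreover have "finite (\<Union>j\<in>\<J>. {x \<in> Z. j \<in> G x})" using J fib by auto
  ultimately have fin: "finite Z" by (rule finite_subset)
  have "card Z * m \<le> (\<Sum>x\<in>Z. card (G x))"
    using sum_bounded_below[of Z m "\<lambda>x. card (G x)"] G by simp
  also have "\<dots> = (\<Sum>x\<in>Z. card {j \<in> \<J>. j \<in> G x})"
  proof (intro sum.cong refl arg_cong[of _ _ card])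
    fix x assume "x \<in> Z" then show "G x = {j \<in> \<J>. j \<in> G x}" using G[of x] by blast
  qed
  also have "\<dots> = (\<Sum>j\<in>\<J>. card {x \<in> Z. j \<in> G x})"
    by (rule sum_multicount_gen[OF fin J]) simp
  also have "\<dots> \<le> card \<J> * D" using sum_bounded_above[of \<J> "\<lambda>j. card {x \<in> Z. j \<in> G x}" D] fib by simp
  finally show ?thesis using fin by simp
qed

theorem theorem7p2:
  fixes fs :: "'n::finite tpoly list" and k n :: nat
  assumes "n = CARD('n)" and "length fs = k" and "k \<ge> n"
    and "\<forall>f\<in>set fs. tropical_poly f \<and> finite_coeffs f"
  shows "finite (isolated_solutions fs) \<and>
    real (card (isolated_solutions fs))
      \<le> real (k choose n) / real (k - n + 1) * real (prod_greatest n (map tdegree fs))"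
proof -
  define A where "A = (\<lambda>i. newton_points (fs ! i))"
  define a where "a = (\<lambda>i. lift (fs ! i))"
  define U where "U = {..<k}"
  define G where "G = (\<lambda>x. {J. J \<subseteq> U \<and> transversal_basis (\<lambda>i. diffs (acell a A x i)) J})"
  define \<J> where "\<J> = {J. J \<subseteq> U \<and> card J = n}"
  let ?Z = "isolated_solutions fs" and ?D = "prod_greatest n (map tdegree fs)"
  have n: "DIM(real ^ 'n) = n" using assms(1) by simp
  have U: "finite U" "card U = k" by (auto simp: U_def)
  have fi: "tropical_poly (fs ! i)" "finite_coeffs (fs ! i)" if "i \<in> U" for i
    using assms(2,4) that by (auto simp: U_def)
  have A: "\<forall>i\<in>U. finite (A i) \<and> A i \<noteq> {}"
    using fi(1) tropical_poly_newton_points by (auto simp: A_def)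
  have sol: "solutions fs = {x. \<forall>i\<in>U. \<nexists>c. acell a A x i = {c}}"
  proof -
    have "set fs = (\<lambda>i. fs ! i) ` U" using assms(2) by (auto simp: set_conv_nth U_def)
    then have "x \<in> solutions fs \<longleftrightarrow> (\<forall>i\<in>U. tropical_zero (fs ! i) x)" for x
      by (simp add: solutions_def)
    then show ?thesis using fi(1) by (auto simp: tropical_zero_iff A_def a_def)
  qed
  have many: "G x \<subseteq> \<J> \<and> k - n + 1 \<le> card (G x)" if x: "x \<in> ?Z" for x
  proof
    show "G x \<subseteq> \<J>" using n by (auto simp: G_def \<J>_def transversal_basis_def)
    have iso: "x isolated_in {x. \<forall>i\<in>U. \<nexists>c. acell a A x i = {c}}"
      using x by (simp add: isolated_solutions_def sol)
    from isolated_tie_transversal[OF U(1) A iso]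
    obtain I where I: "I \<subseteq> U" "transversal_basis (\<lambda>i. diffs (acell a A x i)) I" by (elim exE conjE)
    have "card U - DIM(real ^ 'n) + 1 \<le> card (G x)"
      unfolding G_def
    proof (rule many_transversal_bases[OF U(1) I])
      \<comment> \<open>Two tied exponents of the polynomial differ by a nonzero vector, which is
        all that the exchange requires.\<close>
      fix i assume i: "i \<in> U"
      have "\<nexists>c. acell a A x i = {c}" using iso i by (simp add: isolated_in_def)
      then obtain p q where "p \<in> acell a A x i" "q \<in> acell a A x i" "p \<noteq> q"
        using not_singleton_tcell_iff[of "A i" "\<lambda>p. p" "a i" x] A i by auto
      then show "\<exists>d\<in>diffs (acell a A x i). d \<noteq> 0"
        by (intro bexI[of _ "p - q"]) (auto simp: diffs_def)
    qed
    then show "k - n + 1 \<le> card (G x)" using U(2) n by simp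
  qed
  have fib: "finite {x \<in> ?Z. J \<in> G x} \<and> card {x \<in> ?Z. J \<in> G x} \<le> ?D" if J: "J \<in> \<J>" for J
  proof -
    have JU: "J \<subseteq> U" "finite J" "card J = DIM(real ^ 'n)" using J n U(1) finite_subset by (auto simp: \<J>_def)
    have AJ: "\<forall>i\<in>J. finite (A i) \<and> A i \<noteq> {}" using A JU(1) by blast
    have int: "\<forall>i\<in>J. \<forall>p\<in>A i. integral_vec p"
      by (auto simp: A_def newton_points_def integral_vec_real_vec)
    let ?T = "{x. transversal_basis (\<lambda>i. diffs (acell a A x i)) J}"
    note T = card_transversal_points_le_mvol[OF JU(2,3) AJ int, of a]
    have "mvol J A = (\<Prod>i\<in>J. real (tdegree (fs ! i)))"
    proof (rule mvol_simplices[OF JU(2,3)])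
      fix i assume "i \<in> J"
      then have i: "i \<in> U" using JU(1) by blast
      note s = newton_points_simplex[OF fi[OF i]]
      show "\<And>z. z \<in> A i \<Longrightarrow> (\<forall>b\<in>Basis. 0 \<le> z \<bullet> b) \<and> (\<Sum>b\<in>Basis. z \<bullet> b) \<le> real (tdegree (fs ! i))"
        and "0 \<in> A i" and "\<And>b. b \<in> Basis \<Longrightarrow> real (tdegree (fs ! i)) *\<^sub>R b \<in> A i"
        unfolding A_def by (fact s)+
    qed simp
    also have "\<dots> = real (\<Prod>i\<in>J. map tdegree fs ! i)"
      using JU(1) assms(2) by (auto simp: U_def intro!: prod.cong)
    also have "\<dots> \<le> real ?D"
      using JU n assms(2) by (intro of_nat_mono prod_le_prod_greatest) (auto simp: U_def)
    finally have "card ?T \<le> ?D" using T(2) by linarith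
    moreover have sub: "{x \<in> ?Z. J \<in> G x} \<subseteq> ?T" by (auto simp: G_def)
    ultimately show ?thesis using card_mono[OF T(1) sub] finite_subset[OF sub T(1)] by linarith
  qed
  have "finite ?Z \<and> card ?Z * (k - n + 1) \<le> card \<J> * ?D"
    by (rule card_le_by_multicount[where G = G]) (use many fib U(1) in \<open>auto simp: \<J>_def\<close>)
  moreover have "card \<J> = k choose n" using n_subsets[OF U(1), of n] U(2) by (simp add: \<J>_def)
  ultimately have fin: "finite ?Z" and le: "card ?Z * (k - n + 1) \<le> (k choose n) * ?D" by auto
  have "real (card ?Z) * real (k - n + 1) \<le> real (k choose n) * real ?D"
    using of_nat_mono[OF le, where 'a = real] by (simp only: of_nat_mult)
  then have "real (card ?Z) \<le> real (k choose n) / real (k - n + 1) * real ?D"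
    by (simp add: field_simps)
  then show ?thesis using fin by blast
qed

end
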